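(* Let $N\ge3$, let $\mu$ be the standard Bernoulli measure on $SG_N$, and let $u:SG_N\to\mathbb{R}$ be such that $\Delta_\mu u$ is continuous (that is, $u\in\operatorname{dom}\Delta_\mu$). Then the harmonic gradient $\nabla u(\omega)$ is defined at every $\omega\in\Omega$ such that $$\liminf_{n\to\infty}\frac{C_N(\omega,n)}{\log n}>\frac{1}{|\log\beta_N|}.$$
   Context: **Gasket.** Let $N\ge3$, $S=\{0,\dots,N-1\}$, let $p_0,\dots,p_{N-1}\in\mathbb{R}^{N-1}$ be the vertices of a regular simplex with $|p_j-p_k|=1$ for $j\ne k$, and $F_j(x)=\frac12(x-p_j)+p_j$. $SG_N$ is the unique non-empty compact set with $SG_N=\bigcup_{j=0}^{N-1}F_j(SG_N)$. For $w=w_1\cdots w_m\in S^m$ put $F_w=F_{w_1}\circ\cdots\circ F_{w_m}$. Let $V_0=\{p_0,\dots,p_{N-1}\}$, $V_m=\bigcup_{w\in S^m}F_w(V_0)$; for $x\neq y$ in $V_m$ write $x\sim_my$ if there is $w\in S^m$ with $x,y\in F_w(V_0)$. $\Omega=S^{\mathbb{N}}$ is the set of infinite words $\omega=\omega_1\omega_2\cdots$, and $[\omega]_n=\omega_1\cdots\omega_n$. **Energy.** For continuous $u,v$ on $SG_N$ let $\mathscr{E}_m(u,v)=\left(\frac{N+2}{N}\right)^m\sum_{x\sim_my}(u(x)-u(y))(v(x)-v(y))$ (sum over edges). $\mathscr{E}_m(u,u)$ is non-decreasing in $m$; put $\mathscr{E}(u,u)=\lim_m\mathscr{E}_m(u,u)$,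 $\operatorname{dom}\mathscr{E}=\{u:\mathscr{E}(u,u)<\infty\}$ (continuous functions), $\mathscr{E}(u,v)=\lim_m\mathscr{E}_m(u,v)$ on $\operatorname{dom}\mathscr{E}$; $\operatorname{dom}_0\mathscr{E}$ is the subspace of functions vanishing on $V_0$. **Measure and Laplacian.** The standard Bernoulli measure $\mu$ is the unique Borel probability measure on $SG_N$ with $\mu(A)=\frac1N\sum_{i=0}^{N-1}\mu(F_i^{-1}(A))$ for Borel $A$. For $u\in\operatorname{dom}\mathscr{E}$ and $f$ continuous on $SG_N$, $u\in\operatorname{dom}\Delta_\mu$ with $\Delta_\mu u=f$ means $\mathscr{E}(u,v)=-\int_{SG_N}fv\,d\mu$ for all $v\in\operatorname{dom}_0\mathscr{E}$. **Harmonic functions and gradient.** $h\in\operatorname{dom}\mathscr{E}$ is harmonic if, among functions with the same values on $V_0$, it minimizes $\mathscr{E}_n$ for all $n\ge1$. Harmonic functions are uniquely determined by their (arbitrary) values on $V_0$; they form an $N$-dimensional space $\mathscr{H}$. If $h$ is harmonic so is $h\circ F_i$; let $A_i:\mathscr{H}\to\mathscr{H}$, $A_ih=h\circ F_i$ (in terms of boundary values $A_i$ is the harmonic extension matrix). Let $W\subset\mathscr{H}$ be the constants, $P:\mathscr{H}\to\tilde{\mathscr{H}}=\mathscr{H}/W$ the quotient map, and $\tilde A_i$ the induced map on $\tilde{\mathscr{H}}$ with $\tilde A_i\circ P=P\circ A_i$; it is invertible. For $w=w_1\cdots w_m$, $\tilde A_w=\tilde A_{w_m}\cdots\tilde A_{w_1}$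 is the map induced by $h\mapsto h\circ F_w$, and $\tilde A_w^{-1}$ is its inverse. $\tilde{\mathscr{H}}$ is a finite-dimensional Hilbert space with inner product induced by $\mathscr{E}$; $\|\cdot\|$ is the corresponding operator norm. For continuous $g$ let $H(g)$ be the harmonic function agreeing with $g$ on $V_0$, and $\tilde H(g)=PH(g)$. For $\omega\in\Omega$ set $\nabla_nf(\omega)=\tilde A^{-1}_{[\omega]_n}\tilde H(f\circ F_{[\omega]_n})$; the harmonic gradient $\nabla f(\omega)=\lim_{n\to\infty}\nabla_nf(\omega)$ is defined if the limit exists in $\tilde{\mathscr{H}}$. **Blocks.** An $(N-1)$-block is a word $w_1\cdots w_{N-1}\in S^{N-1}$ with pairwise distinct letters. For $\omega\in\Omega$, $n\in\mathbb{N}$ ($\mathbb{N}=\{1,2,\dots\}$), the block counting function is $$C_N(\omega,n)=\#\{i\in\mathbb{N}: i\le n-(N-2),\ \omega_i\omega_{i+1}\cdots\omega_{i+N-2}\text{ is an }(N-1)\text{-block}\}.$$ **The constant $\beta_N$.** $\beta_N<1$ denotes a constant, depending only on $N$, such that $\frac{1}{N+2}\|\tilde A_w^{-1}\|^{1/(N-1)}\le\beta_N$ for every $(N-1)$-block $w\in S^{N-1}$; such a constant exists (and is necessarily positive). *)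

theory Defs
  imports "HOL-Probability.Probability"
begin

section \<open>The Sierpinski gasket on N vertices\<close>

definition unit_simplex :: "nat \<Rightarrow> (nat \<Rightarrow> 'a::euclidean_space) \<Rightarrow> bool" where
  "unit_simplex N p \<longleftrightarrow> (\<forall>j<N. \<forall>k<N. j \<noteq> k \<longrightarrow> dist (p j) (p k) = 1)"

definition sg_map :: "(nat \<Rightarrow> 'a::euclidean_space) \<Rightarrow> nat \<Rightarrow> 'a \<Rightarrow> 'a" where
  "sg_map p j x = (1/2) *\<^sub>R (x - p j) + p j"

definition sg_word_map :: "(nat \<Rightarrow> 'a::euclidean_space) \<Rightarrow> nat list \<Rightarrow> 'a \<Rightarrow> 'a" where
  "sg_word_map p w = foldr (\<lambda>j g. sg_map p j \<circ> g) w id"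

text \<open>By Hutchinson's theorem exactly one set satisfies this predicate.\<close>

definition is_gasket :: "nat \<Rightarrow> (nat \<Rightarrow> 'a::euclidean_space) \<Rightarrow> 'a set \<Rightarrow> bool" where
  "is_gasket N p K \<longleftrightarrow> compact K \<and> K \<noteq> {} \<and> K = (\<Union>j<N. sg_map p j ` K)"

definition sg_words :: "nat \<Rightarrow> nat \<Rightarrow> nat list set" where
  "sg_words N m = {w. length w = m \<and> set w \<subseteq> {..<N}}"

definition sg_boundary :: "nat \<Rightarrow> (nat \<Rightarrow> 'a::euclidean_space) \<Rightarrow> 'a set" where
  "sg_boundary N p = p ` {..<N}"

definition sg_adj :: "nat \<Rightarrow> (nat \<Rightarrow> 'a::euclidean_space) \<Rightarrow> nat \<Rightarrow> 'a \<Rightarrow> 'a \<Rightarrow> bool" where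
  "sg_adj N p m x y \<longleftrightarrow> x \<noteq> y \<and>
     (\<exists>w\<in>sg_words N m. x \<in> sg_word_map p w ` sg_boundary N p \<and>
                       y \<in> sg_word_map p w ` sg_boundary N p)"

section \<open>Energy\<close>

text \<open>
  Functions on the gasket \<open>K\<close> are functions on the ambient space of which only the values
  on \<open>K\<close> matter; all notions below are insensitive to the values outside \<open>K\<close>.
  The factor 1/2 compensates for summing over ordered pairs: each edge is counted once.
\<close>

definition sg_energy_level ::
    "nat \<Rightarrow> (nat \<Rightarrow> 'a::euclidean_space) \<Rightarrow> nat \<Rightarrow> ('a \<Rightarrow> real) \<Rightarrow> ('a \<Rightarrow> real) \<Rightarrow> real" where
  "sg_energy_level N p m u v = ((real N + 2) / real N) ^ m *
     ((1/2) * (\<Sum>(x, y)\<in>{(x, y). sg_adj N p m x y}. (u x - u y) * (v x - v y)))"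

definition sg_energy ::
    "nat \<Rightarrow> (nat \<Rightarrow> 'a::euclidean_space) \<Rightarrow> ('a \<Rightarrow> real) \<Rightarrow> ('a \<Rightarrow> real) \<Rightarrow> real" where
  "sg_energy N p u v = lim (\<lambda>m. sg_energy_level N p m u v)"

text \<open>The level energies of \<open>u\<close> are non-decreasing, so finiteness of their limit is convergence.\<close>

definition sg_dom ::
    "nat \<Rightarrow> (nat \<Rightarrow> 'a::euclidean_space) \<Rightarrow> 'a set \<Rightarrow> ('a \<Rightarrow> real) set" where
  "sg_dom N p K = {u. continuous_on K u \<and> convergent (\<lambda>m. sg_energy_level N p m u u)}"

definition sg_dom0 ::
    "nat \<Rightarrow> (nat \<Rightarrow> 'a::euclidean_space) \<Rightarrow> 'a set \<Rightarrow> ('a \<Rightarrow> real) set" where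
  "sg_dom0 N p K = {u \<in> sg_dom N p K. \<forall>x\<in>sg_boundary N p. u x = 0}"

section \<open>Bernoulli measure and Laplacian\<close>

text \<open>Exactly one measure satisfies this predicate when \<open>K\<close> is the gasket.\<close>

definition is_standard_bernoulli ::
    "nat \<Rightarrow> (nat \<Rightarrow> 'a::euclidean_space) \<Rightarrow> 'a set \<Rightarrow> 'a measure \<Rightarrow> bool" where
  "is_standard_bernoulli N p K \<mu> \<longleftrightarrow>
     prob_space \<mu> \<and> space \<mu> = K \<and> sets \<mu> = sets (restrict_space borel K) \<and>
     (\<forall>A\<in>sets \<mu>. measure \<mu> A = (1 / real N) * (\<Sum>i<N. measure \<mu> (sg_map p i -` A \<inter> K)))"

definition has_laplacian ::
    "nat \<Rightarrow> (nat \<Rightarrow> 'a::euclidean_space) \<Rightarrow> 'a set \<Rightarrow> 'a measure \<Rightarrow>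
      ('a \<Rightarrow> real) \<Rightarrow> ('a \<Rightarrow> real) \<Rightarrow> bool" where
  "has_laplacian N p K \<mu> u f \<longleftrightarrow> u \<in> sg_dom N p K \<and> continuous_on K f \<and>
     (\<forall>v\<in>sg_dom0 N p K. sg_energy N p u v = - (LINT x|\<mu>. f x * v x))"

definition dom_laplacian ::
    "nat \<Rightarrow> (nat \<Rightarrow> 'a::euclidean_space) \<Rightarrow> 'a set \<Rightarrow> 'a measure \<Rightarrow> ('a \<Rightarrow> real) set" where
  "dom_laplacian N p K \<mu> = {u. \<exists>f. has_laplacian N p K \<mu> u f}"

section \<open>Harmonic functions modulo constants\<close>

definition harmonic_fun ::
    "nat \<Rightarrow> (nat \<Rightarrow> 'a::euclidean_space) \<Rightarrow> 'a set \<Rightarrow> ('a \<Rightarrow> real) set" where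
  "harmonic_fun N p K = {h \<in> sg_dom N p K.
     \<forall>n\<ge>1. \<forall>v. continuous_on K v \<and> (\<forall>x\<in>sg_boundary N p. v x = h x) \<longrightarrow>
       sg_energy_level N p n h h \<le> sg_energy_level N p n v v}"

text \<open>
  The space of harmonic functions modulo constants consists of the classes of the relation
  ``the difference is constant on \<open>K\<close>''. This also identifies
  ambient functions that agree on \<open>K\<close>. Operations on classes are defined through
  representatives; they do not depend on the choice.
\<close>

definition harmonic_rel ::
    "nat \<Rightarrow> (nat \<Rightarrow> 'a::euclidean_space) \<Rightarrow> 'a set \<Rightarrow> (('a \<Rightarrow> real) \<times> ('a \<Rightarrow> real)) set" where
  "harmonic_rel N p K = {(h, k). h \<in> harmonic_fun N p K \<and> k \<in> harmonic_fun N p K \<and>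
     (\<exists>c. \<forall>x\<in>K. h x - k x = c)}"

definition harmonic_quot ::
    "nat \<Rightarrow> (nat \<Rightarrow> 'a::euclidean_space) \<Rightarrow> 'a set \<Rightarrow> ('a \<Rightarrow> real) set set" where
  "harmonic_quot N p K = harmonic_fun N p K // harmonic_rel N p K"

definition hq_class ::
    "nat \<Rightarrow> (nat \<Rightarrow> 'a::euclidean_space) \<Rightarrow> 'a set \<Rightarrow> ('a \<Rightarrow> real) \<Rightarrow> ('a \<Rightarrow> real) set" where
  "hq_class N p K h = harmonic_rel N p K `` {h}"

definition hq_rep :: "('a \<Rightarrow> real) set \<Rightarrow> 'a \<Rightarrow> real" where
  "hq_rep X = (SOME h. h \<in> X)"

definition hq_diff ::
    "nat \<Rightarrow> (nat \<Rightarrow> 'a::euclidean_space) \<Rightarrow> 'a set \<Rightarrow>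
      ('a \<Rightarrow> real) set \<Rightarrow> ('a \<Rightarrow> real) set \<Rightarrow> ('a \<Rightarrow> real) set" where
  "hq_diff N p K X Y = hq_class N p K (\<lambda>x. hq_rep X x - hq_rep Y x)"

definition hq_inner ::
    "nat \<Rightarrow> (nat \<Rightarrow> 'a::euclidean_space) \<Rightarrow> ('a \<Rightarrow> real) set \<Rightarrow> ('a \<Rightarrow> real) set \<Rightarrow> real" where
  "hq_inner N p X Y = sg_energy N p (hq_rep X) (hq_rep Y)"

definition hq_norm ::
    "nat \<Rightarrow> (nat \<Rightarrow> 'a::euclidean_space) \<Rightarrow> ('a \<Rightarrow> real) set \<Rightarrow> real" where
  "hq_norm N p X = sqrt (hq_inner N p X X)"

definition hq_opnorm ::
    "nat \<Rightarrow> (nat \<Rightarrow> 'a::euclidean_space) \<Rightarrow> 'a set \<Rightarrow>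
      (('a \<Rightarrow> real) set \<Rightarrow> ('a \<Rightarrow> real) set) \<Rightarrow> real" where
  "hq_opnorm N p K T = (SUP X\<in>{X \<in> harmonic_quot N p K. hq_norm N p X \<le> 1}. hq_norm N p (T X))"

definition hq_map ::
    "nat \<Rightarrow> (nat \<Rightarrow> 'a::euclidean_space) \<Rightarrow> 'a set \<Rightarrow> nat \<Rightarrow>
      ('a \<Rightarrow> real) set \<Rightarrow> ('a \<Rightarrow> real) set" where
  "hq_map N p K i X = hq_class N p K (hq_rep X \<circ> sg_map p i)"

text \<open>The map of the first letter of the word is applied first.\<close>

definition hq_word_map ::
    "nat \<Rightarrow> (nat \<Rightarrow> 'a::euclidean_space) \<Rightarrow> 'a set \<Rightarrow> nat list \<Rightarrow>
      ('a \<Rightarrow> real) set \<Rightarrow> ('a \<Rightarrow> real) set" where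
  "hq_word_map N p K w = fold (hq_map N p K) w"

definition hq_word_inv ::
    "nat \<Rightarrow> (nat \<Rightarrow> 'a::euclidean_space) \<Rightarrow> 'a set \<Rightarrow> nat list \<Rightarrow>
      ('a \<Rightarrow> real) set \<Rightarrow> ('a \<Rightarrow> real) set" where
  "hq_word_inv N p K w = inv_into (harmonic_quot N p K) (hq_word_map N p K w)"

section \<open>Harmonic gradient\<close>

text \<open>Uniquely determined on \<open>K\<close>; the values outside \<open>K\<close> are arbitrary.\<close>

definition harmonic_ext ::
    "nat \<Rightarrow> (nat \<Rightarrow> 'a::euclidean_space) \<Rightarrow> 'a set \<Rightarrow> ('a \<Rightarrow> real) \<Rightarrow> 'a \<Rightarrow> real" where
  "harmonic_ext N p K g = (SOME h. h \<in> harmonic_fun N p K \<and> (\<forall>x\<in>sg_boundary N p. h x = g x))"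

text \<open>
  Infinite words are functions \<open>\<omega> :: nat \<Rightarrow> nat\<close> with values below \<open>N\<close>; the first letter
  is \<open>\<omega> 0\<close>.
\<close>

definition word_prefix :: "(nat \<Rightarrow> nat) \<Rightarrow> nat \<Rightarrow> nat list" where
  "word_prefix \<omega> n = map \<omega> [0..<n]"

definition gradient_level ::
    "nat \<Rightarrow> (nat \<Rightarrow> 'a::euclidean_space) \<Rightarrow> 'a set \<Rightarrow> ('a \<Rightarrow> real) \<Rightarrow> (nat \<Rightarrow> nat) \<Rightarrow> nat \<Rightarrow>
      ('a \<Rightarrow> real) set" where
  "gradient_level N p K f \<omega> n = hq_word_inv N p K (word_prefix \<omega> n)
     (hq_class N p K (harmonic_ext N p K (f \<circ> sg_word_map p (word_prefix \<omega> n))))"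

definition has_harmonic_gradient ::
    "nat \<Rightarrow> (nat \<Rightarrow> 'a::euclidean_space) \<Rightarrow> 'a set \<Rightarrow> ('a \<Rightarrow> real) \<Rightarrow> (nat \<Rightarrow> nat) \<Rightarrow>
      ('a \<Rightarrow> real) set \<Rightarrow> bool" where
  "has_harmonic_gradient N p K f \<omega> G \<longleftrightarrow> G \<in> harmonic_quot N p K \<and>
     (\<lambda>n. hq_norm N p (hq_diff N p K (gradient_level N p K f \<omega> n) G)) \<longlonglongrightarrow> 0"

definition harmonic_gradient_defined ::
    "nat \<Rightarrow> (nat \<Rightarrow> 'a::euclidean_space) \<Rightarrow> 'a set \<Rightarrow> ('a \<Rightarrow> real) \<Rightarrow> (nat \<Rightarrow> nat) \<Rightarrow> bool" where
  "harmonic_gradient_defined N p K f \<omega> \<longleftrightarrow> (\<exists>G. has_harmonic_gradient N p K f \<omega> G)"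

section \<open>Blocks\<close>

definition blocks :: "nat \<Rightarrow> nat list set" where
  "blocks N = {w \<in> sg_words N (N - 1). distinct w}"

text \<open>
  The window starting at 0-based position \<open>i\<close> is \<open>[i..<i + (N - 1)]\<close>; it has to end within
  the first \<open>n\<close> letters.
\<close>

definition block_count :: "nat \<Rightarrow> (nat \<Rightarrow> nat) \<Rightarrow> nat \<Rightarrow> nat" where
  "block_count N \<omega> n = card {i. i + (N - 1) \<le> n \<and> map \<omega> [i..<i + (N - 1)] \<in> blocks N}"

end

theory Submission
  imports Defs
begin

text \<open>
  Write \<open>w\<close> for the prefix of length \<open>n\<close> of the infinite word and \<open>g\<^sub>n\<close> for the harmonic function that
  agrees with \<open>u\<close> at the vertices of the cell of \<open>w\<close>; the level-\<open>n\<close> gradient is the class of \<open>g\<^sub>n\<close> modulo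
  constants. The gradient exists as soon as the norms of \<open>g\<^bsub>n+1\<^esub> - g\<^sub>n\<close> are summable
  (\<open>gradient_exists_if_summable\<close>), and these norms result from two competing effects.

  On the cell, \<open>u\<close> is nearly harmonic. A tent function at a new vertex of the cell, used as a test
  function in the weak form of the Laplacian, shows that the graph Laplacian of \<open>u\<close> there is at most
  \<open>(N/(N + 2))^(n + 1) N^-n\<close> times the maximum of the absolute Laplacian, where the first factor
  comes from the energy and the second bounds the mass of the cell. By a discrete maximum principle
  the deviation of \<open>u\<close> from harmonic extension, and so the size of \<open>g\<^bsub>n+1\<^esub> - g\<^sub>n\<close> on the next cell, is of order
  \<open>(N + 2)^-n\<close> (\<open>harmonic_deviation_bound\<close>, \<open>gradient_increment_bound\<close>).

  Pulling a harmonic function back from a cell to the whole gasket enlarges its norm by at most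
  \<open>N + 2\<close> for every letter (\<open>boundary_norm_step\<close>). This alone would only give bounded increments, but
  a block of \<open>N - 1\<close> distinct letters costs at most \<open>((N + 2) \<beta>) ^ (N - 1)\<close> by the hypothesis on \<open>\<beta>\<close>.
  Cutting the prefix into single letters and disjoint blocks from its end yields the total factor
  \<open>(N + 2)^n \<beta>^C(n)\<close> with \<open>C\<close> the block counting function (\<open>boundary_norm_prefix\<close>). The increments are
  therefore of order \<open>\<beta>^C(n + 1)\<close>, and the growth condition on \<open>C\<close> makes this summable by comparison
  with a power of \<open>n\<close> (\<open>summable_power_liminf\<close>).

  The formal groundwork is the energy form. Cells of the same level share at most one point, so the
  energy is a sum over words of complete-graph energies. Iterating the extension rule of one
  subdivision step produces continuous functions with given vertex values. An algebraic identity for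
  that step (\<open>complete_form_ext_step\<close>) makes them orthogonal to all functions vanishing at the vertices
  and so identifies them with the energy minimisers (\<open>harmonic_fun_iff\<close>). Through this the quotient space reduces to vertex values.
\<close>

section \<open>Energy on a complete graph and harmonic extension\<close>

definition complete_form :: "nat \<Rightarrow> (nat \<Rightarrow> real) \<Rightarrow> (nat \<Rightarrow> real) \<Rightarrow> real" where
  "complete_form N a b = (1/2) * (\<Sum>i<N. \<Sum>j<N. (a i - a j) * (b i - b j))"

text \<open>
  The values which a harmonic function with vertex values \<open>a\<close> takes at the vertices of the \<open>i\<close>-th
  subcell, that is, the harmonic extension matrix \<open>A\<^sub>i\<close>. For \<open>j \<noteq> i\<close> the value is the one at the midpoint
  of vertices \<open>i\<close> and \<open>j\<close>, which subcells \<open>i\<close> and \<open>j\<close> share; whence the symmetry in \<open>i\<close> and \<open>j\<close>.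
\<close>

definition ext_step :: "nat \<Rightarrow> nat \<Rightarrow> (nat \<Rightarrow> real) \<Rightarrow> nat \<Rightarrow> real" where
  "ext_step N i a j = (if j = i then a i else (a i + a j + sum a {..<N}) / (real N + 2))"

lemma complete_form_eq:
  "complete_form N a b = (\<Sum>j<N. b j * (real N * a j - sum a {..<N}))"
proof -
  have "(\<Sum>i<N. \<Sum>j<N. (a i - a j) * (b i - b j))
      = (\<Sum>i<N. \<Sum>j<N. a i * b i) - (\<Sum>i<N. \<Sum>j<N. a i * b j)
        - (\<Sum>i<N. \<Sum>j<N. a j * b i) + (\<Sum>i<N. \<Sum>j<N. a j * b j)"
    by (simp add: sum.distrib sum_subtractf algebra_simps)
  also have "(\<Sum>i<N. \<Sum>j<N. a i * b j) = (\<Sum>i<N. \<Sum>j<N. a j * b i)"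
    by (rule sum.swap)
  also have "(\<Sum>i<N. \<Sum>j<N. a j * b i) = sum a {..<N} * sum b {..<N}"
    by (simp add: sum_distrib_right sum_distrib_left sum_product mult.commute)
  also have "(\<Sum>i<N. \<Sum>j<N. a i * b i) = real N * (\<Sum>j<N. a j * b j)"
    by (simp add: sum_distrib_left)
  also have "(\<Sum>i<N. \<Sum>j<N. a j * b j) = real N * (\<Sum>j<N. a j * b j)"
    by simp
  finally have "complete_form N a b = real N * (\<Sum>j<N. a j * b j) - sum a {..<N} * sum b {..<N}"
    by (simp add: complete_form_def)
  also have "\<dots> = (\<Sum>j<N. b j * (real N * a j - sum a {..<N}))"
    by (simp add: right_diff_distrib sum_subtractf sum_distrib_left sum_distrib_right mult_ac)
  finally show ?thesis .
qed

lemma complete_form_cong: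
  assumes "\<And>i. i < N \<Longrightarrow> a i = a' i" "\<And>i. i < N \<Longrightarrow> b i = b' i"
  shows "complete_form N a b = complete_form N a' b'"
  unfolding complete_form_def using assms by simp

lemma complete_form_commute: "complete_form N a b = complete_form N b a"
  unfolding complete_form_def by (simp add: mult.commute)

lemma complete_form_diff_left:
  "complete_form N (\<lambda>i. a i - a' i) b = complete_form N a b - complete_form N a' b"
  unfolding complete_form_def right_diff_distrib[symmetric] sum_subtractf[symmetric]
  by (simp add: algebra_simps)

lemma complete_form_scale:
  "complete_form N (\<lambda>i. c * a i) (\<lambda>i. c * a i) = c\<^sup>2 * complete_form N a a"
  unfolding complete_form_def sum_distrib_left
  by (intro sum.cong refl) (simp add: algebra_simps power2_eq_square)

lemma complete_form_shift:
  assumes "\<And>i. i < N \<Longrightarrow> a i - b i = c"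
  shows "complete_form N a a = complete_form N b b"
proof -
  have "a i - a j = b i - b j" if "i < N" "j < N" for i j
    using assms[OF that(1)] assms[OF that(2)] by simp
  then show ?thesis unfolding complete_form_def by simp
qed

lemma complete_form_nonneg: "0 \<le> complete_form N a a"
  unfolding complete_form_def by (simp add: sum_nonneg)

lemma diff_le_sqrt_complete_form:
  assumes "i < N" "j < N"
  shows "\<bar>a i - a j\<bar> \<le> sqrt (complete_form N a a)"
proof (cases "i = j")
  case True
  then show ?thesis by (simp add: complete_form_nonneg)
next
  case False
  let ?g = "\<lambda>(i,j). (a i - a j) * (a i - a j)"
  have "(\<Sum>x\<in>{(i,j),(j,i)}. ?g x) \<le> (\<Sum>x\<in>{..<N}\<times>{..<N}. ?g x)"
    by (rule sum_mono2) (use assms in auto)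
  then have "2 * (a i - a j)\<^sup>2 \<le> 2 * complete_form N a a"
    using False
    by (simp add: complete_form_def sum.cartesian_product power2_eq_square algebra_simps)
  then show ?thesis by (simp add: real_le_rsqrt)
qed

lemma sum_ext_step:
  assumes "i < N"
  shows "sum (ext_step N i a) {..<N} = real N * (2 * a i + sum a {..<N}) / (real N + 2)"
proof -
  have "sum (ext_step N i a) {..<N} = a i + (\<Sum>j\<in>{..<N}-{i}. ext_step N i a j)"
    using assms by (subst sum.remove[of _ i]) (auto simp: ext_step_def)
  also have "(\<Sum>j\<in>{..<N}-{i}. ext_step N i a j)
      = (\<Sum>j\<in>{..<N}-{i}. (a i + sum a {..<N} + a j) / (real N + 2))"
    by (intro sum.cong) (auto simp: ext_step_def)
  also have "\<dots> = (\<Sum>j\<in>{..<N}-{i}. a i + sum a {..<N} + a j) / (real N + 2)"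
    by (simp add: sum_divide_distrib)
  also have "(\<Sum>j\<in>{..<N}-{i}. a i + sum a {..<N} + a j)
     = (real N - 1) * (a i + sum a {..<N}) + (sum a {..<N} - a i)"
    using assms by (simp add: sum.distrib sum_diff1 of_nat_diff)
  finally show ?thesis by (simp add: field_simps)
qed

lemma ext_step_laplacian:
  assumes "i < N" "j < N"
  shows "real N * ext_step N i a j - sum (ext_step N i a) {..<N}
    = real N / (real N + 2) * (if j = i then real N * a i - sum a {..<N} else a j - a i)"
proof (cases "j = i")
  case True
  have "a i = (real N + 2) * a i / (real N + 2)" by simp
  then have "real N * a i - real N * (2 * a i + sum a {..<N}) / (real N + 2)
      = (real N * ((real N + 2) * a i) - real N * (2 * a i + sum a {..<N})) / (real N + 2)"
    by (metis diff_divide_distrib times_divide_eq_right)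
  also have "\<dots> = real N / (real N + 2) * (real N * a i - sum a {..<N})"
    by (simp add: algebra_simps diff_divide_distrib)
  finally show ?thesis
    using True unfolding sum_ext_step[OF assms(1)] by (simp add: ext_step_def)
next
  case False
  then show ?thesis
    unfolding sum_ext_step[OF assms(1)]
    by (simp add: ext_step_def add_divide_distrib diff_divide_distrib algebra_simps)
qed

text \<open>
  The whole energy theory rests on this identity. By \<open>ext_step_laplacian\<close>, the graph
  Laplacian of \<open>ext_step N i a\<close> at \<open>j \<noteq> i\<close> is antisymmetric in \<open>i\<close> and \<open>j\<close>, so when it is paired with a
  symmetric array \<open>m\<close> all contributions of the midpoints cancel and only the corners remain. Taking
  for \<open>m\<close> the harmonic extension itself shows that harmonic extension preserves the renormalised
  energy; a general \<open>m\<close> shows that it is orthogonal to everything vanishing at the corners.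
\<close>

lemma complete_form_ext_step:
  assumes "N \<ge> 1"
  assumes sym: "\<And>i j. i < N \<Longrightarrow> j < N \<Longrightarrow> m i j = m j i"
  shows "(real N + 2) / real N * (\<Sum>i<N. complete_form N (ext_step N i a) (m i))
    = complete_form N a (\<lambda>i. m i i)"
proof -
  let ?r = "real N / (real N + 2)"
  let ?S = "sum a {..<N}"
  have "complete_form N (ext_step N i a) (m i)
      = ?r * (m i i * (real N * a i - ?S) + (\<Sum>j<N. m i j * (a j - a i)))" if "i < N" for i
  proof -
    have "complete_form N (ext_step N i a) (m i)
      = (\<Sum>j<N. m i j * (?r * (if j = i then real N * a i - ?S else a j - a i)))"
      unfolding complete_form_eq
      by (intro sum.cong refl) (use that ext_step_laplacian in force)
    also have "\<dots> = ?r * (\<Sum>j<N. (if j = i then m i i * (real N * a i - ?S) else 0) + m i j * (a j - a i))"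
      unfolding sum_distrib_left by (intro sum.cong refl) auto
    finally show ?thesis using that by (simp add: sum.distrib)
  qed
  then have "(\<Sum>i<N. complete_form N (ext_step N i a) (m i))
      = ?r * ((\<Sum>i<N. m i i * (real N * a i - ?S)) + (\<Sum>i<N. \<Sum>j<N. m i j * (a j - a i)))"
    by (simp add: sum_distrib_left sum.distrib distrib_left)
  moreover have "(\<Sum>i<N. \<Sum>j<N. m i j * (a j - a i)) = 0"
  proof -
    have "(\<Sum>i<N. \<Sum>j<N. m i j * (a j - a i)) = (\<Sum>i<N. \<Sum>j<N. m j i * (a i - a j))"
      by (rule sum.swap)
    also have "\<dots> = (\<Sum>i<N. \<Sum>j<N. - (m i j * (a j - a i)))"
      by (intro sum.cong refl) (simp add: sym algebra_simps)
    finally show ?thesis by (simp add: sum_negf)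
  qed
  ultimately show ?thesis using \<open>N \<ge> 1\<close> by (simp add: complete_form_eq)
qed

text \<open>
  This says that the inverse of the map induced by \<open>A\<^sub>i\<close> modulo constants has norm at most \<open>N + 2\<close>. With
  \<open>d\<^sub>j = a\<^sub>j - a\<^sub>i\<close> and \<open>s = \<Sum>\<^sub>j d\<^sub>j\<close>, the array \<open>(N + 2) A\<^sub>i a\<close> is, up to a constant, \<open>d\<^sub>j + s\<close> for
  \<open>j \<noteq> i\<close> and \<open>0\<close> at \<open>i\<close>; adding \<open>s\<close> raises the energy by exactly \<open>(N + 1) s\<^sup>2\<close>.
\<close>

lemma complete_form_ext_step_lower:
  assumes "i < N"
  shows "complete_form N a a \<le> (real N + 2)\<^sup>2 * complete_form N (ext_step N i a) (ext_step N i a)"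
proof -
  let ?S = "sum a {..<N}"
  let ?s = "?S - real N * a i"
  define d where "d = (\<lambda>j. a j - a i)"
  have sd: "sum d {..<N} = ?s" by (simp add: d_def sum_subtractf)
  define e where "e = (\<lambda>j. if j = i then 0 else d j + ?s)"
  have e: "(real N + 2) * ext_step N i a j = e j + (real N + 2) * a i" for j
    by (simp add: e_def d_def ext_step_def) (simp add: algebra_simps)
  have "(real N + 2)\<^sup>2 * complete_form N (ext_step N i a) (ext_step N i a) = complete_form N e e"
    unfolding complete_form_scale[symmetric]
    by (rule complete_form_shift[of _ _ _ "(real N + 2) * a i"]) (simp add: e)
  moreover have "complete_form N a a = complete_form N d d"
    by (rule complete_form_shift[of _ _ _ "a i"]) (simp add: d_def)
  moreover have "complete_form N d d \<le> complete_form N e e"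
  proof -
    have di: "d i = 0" by (simp add: d_def)
    have se: "sum e {..<N} = real N * ?s"
    proof -
      have "sum e {..<N} = (\<Sum>j\<in>{..<N}. (d j + ?s) - (if j = i then ?s else 0))"
        by (intro sum.cong) (auto simp: e_def di)
      then show ?thesis using assms sd by (simp add: sum_subtractf sum.distrib)
    qed
    have se2: "(\<Sum>j<N. (e j)\<^sup>2) = (\<Sum>j<N. (d j)\<^sup>2) + 2 * ?s\<^sup>2 + (real N - 1) * ?s\<^sup>2"
    proof -
      have "(\<Sum>j<N. (e j)\<^sup>2) = (\<Sum>j\<in>{..<N}. (d j)\<^sup>2 + 2 * ?s * d j + ?s\<^sup>2 - (if j = i then ?s\<^sup>2 else 0))"
        by (intro sum.cong) (auto simp: e_def di power2_eq_square algebra_simps)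
      also have "\<dots> = (\<Sum>j<N. (d j)\<^sup>2) + 2 * ?s * sum d {..<N} + real N * ?s\<^sup>2 - ?s\<^sup>2"
        using assms by (simp add: sum_subtractf sum.distrib sum_distrib_left)
      finally show ?thesis by (simp add: sd power2_eq_square algebra_simps)
    qed
    have f: "complete_form N f f = real N * (\<Sum>j<N. (f j)\<^sup>2) - (sum f {..<N})\<^sup>2" for f
      by (simp add: complete_form_eq right_diff_distrib sum_subtractf sum_distrib_left
          sum_distrib_right power2_eq_square mult_ac)
    have "complete_form N e e - complete_form N d d = (real N + 1) * ?s\<^sup>2"
      unfolding f se se2 sd by (simp add: power2_eq_square algebra_simps)
    moreover have "(real N + 1) * ?s\<^sup>2 \<ge> 0" by simp
    ultimately show ?thesis by linarith
  qed
  ultimately show ?thesis by simp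
qed

text \<open>
  Each value of \<open>ext_step\<close> is a weighted mean of the \<open>a\<^sub>k\<close> with weight at least \<open>2/(N + 2)\<close> at \<open>i\<close>,
  hence the oscillation over subcells decays geometrically. This makes the iterated extension
  converge to a continuous function.
\<close>

lemma ext_step_contracts:
  assumes i: "i < N" and osc: "\<And>j k. j < N \<Longrightarrow> k < N \<Longrightarrow> \<bar>a j - a k\<bar> \<le> c"
    and j: "j < N" and k: "k < N"
  shows "\<bar>ext_step N i a j - ext_step N i a k\<bar> \<le> real N / (real N + 2) * c"
proof -
  have c: "c \<ge> 0" using osc[OF i i] by simp
  have aux: "\<bar>a i - ext_step N i a l\<bar> \<le> real N / (real N + 2) * c" if l: "l < N" "l \<noteq> i" for l
  proof -
    have "a i - ext_step N i a l = ((a i - a l) + (\<Sum>m<N. a i - a m)) / (real N + 2)"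
      using l by (simp add: ext_step_def sum_subtractf field_simps)
    also have "(\<Sum>m<N. a i - a m) = (\<Sum>m\<in>{..<N}-{i}. a i - a m)"
      using i by (subst sum.remove[of _ i]) auto
    finally have "\<bar>a i - ext_step N i a l\<bar> = \<bar>(a i - a l) + (\<Sum>m\<in>{..<N}-{i}. a i - a m)\<bar> / (real N + 2)"
      by simp
    moreover have "\<bar>\<Sum>m\<in>{..<N}-{i}. a i - a m\<bar> \<le> (\<Sum>m\<in>{..<N}-{i}. c)"
      by (rule order.trans[OF sum_abs]) (intro sum_mono osc; use i in auto)
    then have "\<bar>\<Sum>m\<in>{..<N}-{i}. a i - a m\<bar> \<le> (real N - 1) * c"
      using i by (simp add: of_nat_diff)
    moreover have "\<bar>a i - a l\<bar> \<le> c" using osc i l by simp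
    ultimately have "\<bar>a i - ext_step N i a l\<bar> \<le> (c + (real N - 1) * c) / (real N + 2)"
      by (simp add: divide_right_mono)
    then show ?thesis by (simp add: algebra_simps)
  qed
  have ii: "ext_step N i a i = a i" by (simp add: ext_step_def)
  consider "j = i" "k = i" | "j = i" "k \<noteq> i" | "j \<noteq> i" "k = i" | "j \<noteq> i" "k \<noteq> i" by blast
  then show ?thesis
  proof cases
    case 1 then show ?thesis using c by simp
  next
    case 2 then show ?thesis using aux[of k] k ii by simp
  next
    case 3 then show ?thesis using aux[of j] j ii by (simp add: abs_minus_commute)
  next
    case 4
    then have "\<bar>ext_step N i a j - ext_step N i a k\<bar> = \<bar>a j - a k\<bar> / (real N + 2)"
      by (simp add: ext_step_def field_simps flip: diff_divide_distrib)
    also have "\<dots> \<le> c / (real N + 2)" using osc j k by (simp add: divide_right_mono)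
    also have "\<dots> \<le> real N / (real N + 2) * c"
    proof -
      have "1 * c \<le> real N * c" using i c by (intro mult_right_mono) auto
      then show ?thesis by (simp add: divide_right_mono)
    qed
    finally show ?thesis .
  qed
qed

section \<open>Barycentric coordinates and the cells of the gasket\<close>

locale gasket =
  fixes N :: nat and p :: "nat \<Rightarrow> 'a::euclidean_space" and K :: "'a set"
  assumes N_ge_3: "N \<ge> 3"
    and simplex: "unit_simplex N p"
    and is_gasket: "is_gasket N p K"
begin

text \<open>
  Barycentric coordinates with respect to a regular simplex of side 1 are explicit affine functions
  built from inner products with the vectors from the centroid; the factor 2 comes from
  \<open>(p\<^sub>j - c) \<bullet> (p\<^sub>i - c) = \<delta>\<^sub>i\<^sub>j/2 - 1/(2N)\<close>.
\<close>

definition centroid :: 'a where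
  "centroid = (1 / real N) *\<^sub>R (\<Sum>j<N. p j)"

definition bary :: "nat \<Rightarrow> 'a \<Rightarrow> real" where
  "bary i x = 1 / real N + 2 * ((x - centroid) \<bullet> (p i - centroid))"

lemma inner_vertices:
  assumes "i < N" "j < N"
  shows "p i \<bullet> p j = (p i \<bullet> p i + p j \<bullet> p j - 1 + (if i = j then 1 else 0)) / 2"
proof (cases "i = j")
  case False
  then have "dist (p i) (p j) = 1" using simplex assms by (auto simp: unit_simplex_def)
  then have "(p i - p j) \<bullet> (p i - p j) = 1"
    by (simp add: dist_norm norm_eq_sqrt_inner)
  then show ?thesis using False by (simp add: inner_diff inner_commute)
qed simp

lemma bary_vertex:
  assumes i: "i < N" and j: "j < N"
  shows "bary i (p j) = (if i = j then 1 else 0)"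
proof -
  have N: "real N \<noteq> 0" using N_ge_3 by simp
  define P where "P = (\<Sum>k<N. p k \<bullet> p k) / real N"
  have cp: "centroid \<bullet> p l = (P + p l \<bullet> p l - 1 + 1 / real N) / 2" if l: "l < N" for l
  proof -
    have "(\<Sum>k<N. p k \<bullet> p l)
        = (\<Sum>k<N. (p k \<bullet> p k + p l \<bullet> p l - 1 + (if k = l then 1 else 0)) / 2)"
      by (intro sum.cong refl inner_vertices) (use l in auto)
    also have "\<dots> = (real N * P + real N * (p l \<bullet> p l) - real N + 1) / 2"
      using l N by (simp add: P_def sum.distrib sum_subtractf flip: sum_divide_distrib)
    finally show ?thesis
      using N by (simp add: centroid_def inner_sum_left field_simps)
  qed
  have "centroid \<bullet> centroid = (1 / real N) * (\<Sum>k<N. centroid \<bullet> p k)"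
    by (subst (2) centroid_def) (simp add: inner_sum_right)
  also have "(\<Sum>k<N. centroid \<bullet> p k) = (\<Sum>k<N. (P + p k \<bullet> p k - 1 + 1 / real N) / 2)"
    by (intro sum.cong refl cp) auto
  also have "\<dots> = (real N * P + real N * P - real N + 1) / 2"
    using N by (simp add: P_def sum.distrib sum_subtractf flip: sum_divide_distrib)
  finally have cc: "centroid \<bullet> centroid = P - 1 / 2 + 1 / (2 * real N)"
    using N by (simp add: field_simps)
  have "(p j - centroid) \<bullet> (p i - centroid)
      = p i \<bullet> p j - centroid \<bullet> p i - centroid \<bullet> p j + centroid \<bullet> centroid"
    by (simp add: inner_diff inner_commute)
  also have "\<dots> = (if i = j then 1 / 2 else 0) - 1 / (2 * real N)"
    unfolding inner_vertices[OF i j] cp[OF i] cp[OF j] cc using N by (simp add: field_simps)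
  finally show ?thesis using N by (simp add: bary_def)
qed

lemma bary_sg_map:
  assumes "i < N" "j < N"
  shows "bary i (sg_map p j x) = (bary i x + (if i = j then 1 else 0)) / 2"
proof -
  have "bary i (sg_map p j x) = (bary i x + bary i (p j)) / 2"
    unfolding bary_def sg_map_def by (simp add: inner_diff_left inner_add_left algebra_simps)
  then show ?thesis using bary_vertex[OF assms] by simp
qed

lemma continuous_on_bary: "continuous_on A (bary i)"
  unfolding bary_def by (intro continuous_intros)

lemma inj_on_vertices: "inj_on p {..<N}"
proof (rule inj_onI)
  fix i j assume "i \<in> {..<N}" "j \<in> {..<N}" "p i = p j"
  then show "i = j" using bary_vertex[of i i] bary_vertex[of i j] by (auto split: if_splits)
qed

lemma vertex_eq_iff: "i < N \<Longrightarrow> j < N \<Longrightarrow> p i = p j \<longleftrightarrow> i = j"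
  using inj_on_vertices by (auto simp: inj_on_def)

lemma compact_K: "compact K" and K_nonempty: "K \<noteq> {}" and K_eq: "K = (\<Union>j<N. sg_map p j ` K)"
  using is_gasket by (auto simp: is_gasket_def)

lemma sg_map_in_K: "j < N \<Longrightarrow> x \<in> K \<Longrightarrow> sg_map p j x \<in> K"
  using K_eq by blast

lemma K_cases:
  assumes "x \<in> K"
  obtains j y where "j < N" "y \<in> K" "x = sg_map p j y"
  using assms K_eq by blast

lemma sg_map_inj: "sg_map p j x = sg_map p j y \<longleftrightarrow> x = y"
  by (simp add: sg_map_def)

lemma sg_map_vertex: "sg_map p j (p j) = p j"
  by (simp add: sg_map_def)

lemma sg_map_eq: "sg_map p j x = (1/2) *\<^sub>R (x + p j)"
proof -
  define h where "h = (1/2) *\<^sub>R p j"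
  have "p j = h + h"
    using scaleR_half_double[of "p j"] unfolding scaleR_add_right h_def by simp
  then have "(1/2) *\<^sub>R x - h + p j = (1/2) *\<^sub>R x + h" by simp
  then show ?thesis
    unfolding sg_map_def scaleR_right_diff_distrib scaleR_add_right h_def .
qed

lemma sg_map_swap: "sg_map p i (p j) = sg_map p j (p i)"
  by (simp add: sg_map_eq add.commute)

lemma continuous_on_sg_map: "continuous_on A (sg_map p j)"
  unfolding sg_map_def[abs_def] by (intro continuous_intros)

lemma vertex_in_K:
  assumes j: "j < N"
  shows "p j \<in> K"
proof -
  obtain x where x: "x \<in> K" using K_nonempty by blast
  define s where "s n = (sg_map p j ^^ n) x" for n
  have s: "s n \<in> K" for n
    by (induction n) (auto simp: s_def x sg_map_in_K j)
  have s_eq: "s n = (1/2)^n *\<^sub>R (x - p j) + p j" for n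
    by (induction n) (auto simp: s_def sg_map_def)
  have "s \<longlonglongrightarrow> 0 *\<^sub>R (x - p j) + p j"
    unfolding s_eq[abs_def] by (intro tendsto_intros LIMSEQ_realpow_zero) auto
  then show ?thesis
    using compact_imp_closed[OF compact_K] s by (auto simp: closed_sequential_limits)
qed

text \<open>
  At a minimum over \<open>K\<close>, written as the image of another point of \<open>K\<close> under some \<open>F\<^sub>j\<close>, the coordinate is at
  least half of a value that is itself at least the minimum.
\<close>

lemma bary_nonneg:
  assumes "x \<in> K" "i < N"
  shows "bary i x \<ge> 0"
proof -
  obtain y where y: "y \<in> K" "\<And>z. z \<in> K \<Longrightarrow> bary i y \<le> bary i z"
    using continuous_attains_inf[OF compact_K K_nonempty continuous_on_bary] by blast
  obtain j z where z: "j < N" "z \<in> K" "y = sg_map p j z" using K_cases[OF y(1)] .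
  have "bary i y \<ge> bary i z / 2" using z assms bary_sg_map[of i j z] by auto
  then have "bary i y \<ge> 0" using y(2)[OF z(2)] by linarith
  then show ?thesis using y(2)[OF assms(1)] by linarith
qed

text \<open>
  The residual \<open>r\<close> of the barycentric expansion is halved by every \<open>F\<^sub>j\<close>, so its maximal norm over \<open>K\<close>
  is at most half of itself.
\<close>

lemma bary_representation:
  assumes "x \<in> K"
  shows "x = (\<Sum>i<N. bary i x *\<^sub>R p i)"
proof -
  define r where "r x = x - (\<Sum>i<N. bary i x *\<^sub>R p i)" for x
  have r: "r (sg_map p j x) = (1/2) *\<^sub>R r x" if j: "j < N" for j x
  proof -
    have "(\<Sum>i<N. bary i (sg_map p j x) *\<^sub>R p i)
       = (\<Sum>i<N. (1/2) *\<^sub>R (bary i x *\<^sub>R p i) + (if i = j then (1/2) *\<^sub>R p j else 0))"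
      by (intro sum.cong refl) (use j bary_sg_map[of _ j x] in \<open>auto simp: add_divide_distrib scaleR_left_distrib\<close>)
    also have "\<dots> = (1/2) *\<^sub>R (\<Sum>i<N. bary i x *\<^sub>R p i) + (1/2) *\<^sub>R p j"
      using j by (simp add: sum.distrib scaleR_sum_right)
    finally show ?thesis
      unfolding r_def sg_map_eq by (simp add: scaleR_add_right scaleR_right_diff_distrib)
  qed
  have "continuous_on K (\<lambda>x. norm (r x))"
    unfolding r_def by (intro continuous_intros continuous_on_bary)
  then obtain y where y: "y \<in> K" "\<And>z. z \<in> K \<Longrightarrow> norm (r z) \<le> norm (r y)"
    using continuous_attains_sup[OF compact_K K_nonempty] by blast
  obtain j z where z: "j < N" "z \<in> K" "y = sg_map p j z" using K_cases[OF y(1)] .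
  have "norm (r y) = norm (r z) / 2" using z r by simp
  then have "norm (r y) \<le> 0" using y(2)[OF z(2)] by linarith
  then have "norm (r x) \<le> 0" using y(2)[OF assms] by linarith
  then show ?thesis by (simp add: r_def)
qed

lemma sum_bary: "(\<Sum>i<N. bary i x) = 1"
proof -
  have "real N *\<^sub>R centroid = (\<Sum>i<N. p i)"
    using N_ge_3 by (simp add: centroid_def)
  then have "(\<Sum>i<N. p i - centroid) = 0"
    by (simp add: sum_subtractf sum_constant_scaleR)
  then have "(\<Sum>i<N. 2 * ((x - centroid) \<bullet> (p i - centroid))) = 0"
    by (simp flip: sum_distrib_left inner_sum_right)
  then show ?thesis using N_ge_3 unfolding bary_def sum.distrib by simp
qed

lemma bary_ge_1_imp_vertex:
  assumes x: "x \<in> K" and k: "k < N" and b: "bary k x \<ge> 1"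
  shows "x = p k"
proof -
  have s: "bary k x + (\<Sum>i\<in>{..<N}-{k}. bary i x) = 1"
    using sum_bary[of x] k by (subst (asm) sum.remove[of _ k]) auto
  have "(\<Sum>i\<in>{..<N}-{k}. bary i x) \<ge> 0"
    by (intro sum_nonneg bary_nonneg x) auto
  then have b1: "bary k x = 1" and s0: "(\<Sum>i\<in>{..<N}-{k}. bary i x) = 0" using s b by auto
  have b0: "bary i x = 0" if "i < N" "i \<noteq> k" for i
    using s0 that by (subst (asm) sum_nonneg_eq_0_iff) (auto intro: bary_nonneg x)
  have "(\<Sum>i<N. bary i x *\<^sub>R p i) = (\<Sum>i<N. if i = k then p k else 0)"
    by (intro sum.cong) (auto simp: b1 b0)
  then show ?thesis using bary_representation[OF x] k by simp
qed

text \<open>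
  If \<open>F\<^sub>i x = F\<^sub>k y\<close> then half the \<open>k\<close>-th coordinate of \<open>x\<close> equals \<open>(b\<^sub>k(y) + 1)/2 \<ge> 1/2\<close>, which
  forces \<open>x\<close> to be the vertex \<open>p\<^sub>k\<close>.
\<close>

lemma cells_meet:
  assumes "x \<in> K" "y \<in> K" "i < N" "k < N" "i \<noteq> k" "sg_map p i x = sg_map p k y"
  shows "x = p k" "y = p i"
proof -
  have *: "x = p k" if "x \<in> K" "y \<in> K" "i < N" "k < N" "i \<noteq> k" "sg_map p i x = sg_map p k y"
    for x y i k
  proof (rule bary_ge_1_imp_vertex)
    have "bary k (sg_map p i x) = bary k x / 2" using that(3-5) by (simp add: bary_sg_map)
    moreover have "bary k (sg_map p k y) = (bary k y + 1) / 2" using that(4) by (simp add: bary_sg_map)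
    moreover have "bary k y \<ge> 0" using that by (simp add: bary_nonneg)
    ultimately show "1 \<le> bary k x" using that(6) by simp
  qed (use that in auto)
  show "x = p k" using *[OF assms] .
  show "y = p i" by (rule *[of y x k i]) (use assms in auto)
qed

section \<open>Words\<close>

lemma sg_word_map_Nil [simp]: "sg_word_map p [] = id"
  by (simp add: sg_word_map_def)

lemma sg_word_map_Cons [simp]: "sg_word_map p (i # w) = sg_map p i \<circ> sg_word_map p w"
  by (simp add: sg_word_map_def)

lemma sg_word_map_append: "sg_word_map p (v @ w) = sg_word_map p v \<circ> sg_word_map p w"
  by (induction v) (auto simp: comp_assoc)

lemma sg_word_map_in_K: "set w \<subseteq> {..<N} \<Longrightarrow> x \<in> K \<Longrightarrow> sg_word_map p w x \<in> K"
  by (induction w) (auto simp: sg_map_in_K)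

lemma sg_word_map_inj: "sg_word_map p w x = sg_word_map p w y \<longleftrightarrow> x = y"
  by (induction w) (auto simp: sg_map_inj)

lemma continuous_on_sg_word_map: "continuous_on A (sg_word_map p w)"
proof (induction w)
  case (Cons i w)
  then show ?case using continuous_on_compose[OF Cons continuous_on_sg_map] by simp
qed auto

lemma dist_sg_word_map: "dist (sg_word_map p w x) (sg_word_map p w y) = (1/2) ^ length w * dist x y"
proof (induction w)
  case (Cons i w)
  have "dist (sg_map p i a) (sg_map p i b) = (1/2) * dist a b" for a b
    by (simp add: sg_map_def dist_norm flip: scaleR_right_diff_distrib)
  then show ?case using Cons by simp
qed simp

lemma K_word_cases:
  assumes "x \<in> K"
  obtains w y where "length w = n" "set w \<subseteq> {..<N}" "y \<in> K" "x = sg_word_map p w y"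
  using assms
proof (induction n arbitrary: x thesis)
  case (Suc n)
  obtain j y where y: "j < N" "y \<in> K" "x = sg_map p j y" using K_cases[OF Suc.prems(2)] .
  obtain w z where "length w = n" "set w \<subseteq> {..<N}" "z \<in> K" "y = sg_word_map p w z"
    using Suc.IH[OF _ y(2)] by metis
  then show ?case using y by (intro Suc.prems(1)[of "j # w" z]) auto
qed auto

text \<open>
  Two words that first differ at some letter have cells meeting in at most one point, by \<open>cells_meet\<close>.
  Hence every edge of the level graph lies in exactly one cell, which turns the sum over edges in
  the definition of the energy into a sum over words.
\<close>

lemma word_cells_share_two_points:
  assumes "length v = length w" "set v \<subseteq> {..<N}" "set w \<subseteq> {..<N}"
    and "x \<in> K" "x' \<in> K" "y \<in> K" "y' \<in> K" "x \<noteq> y"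
    and "sg_word_map p v x = sg_word_map p w x'" "sg_word_map p v y = sg_word_map p w y'"
  shows "v = w"
  using assms
proof (induction v w rule: list_induct2)
  case (Cons i v k w)
  have i: "i < N" "k < N" and vw: "set v \<subseteq> {..<N}" "set w \<subseteq> {..<N}" using Cons.prems by auto
  have "i = k"
  proof (rule ccontr)
    assume "i \<noteq> k"
    have "sg_word_map p v x = p k"
      by (rule cells_meet[of _ "sg_word_map p w x'" i k])
        (use Cons.prems i vw \<open>i \<noteq> k\<close> in \<open>auto simp: sg_word_map_in_K\<close>)
    moreover have "sg_word_map p v y = p k"
      by (rule cells_meet[of _ "sg_word_map p w y'" i k])
        (use Cons.prems i vw \<open>i \<noteq> k\<close> in \<open>auto simp: sg_word_map_in_K\<close>)
    ultimately show False using Cons.prems by (metis sg_word_map_inj)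
  qed
  moreover have "v = w"
    by (rule Cons.IH) (use Cons.prems \<open>i = k\<close> in \<open>auto simp: sg_map_inj\<close>)
  ultimately show ?case by simp
qed simp

lemma finite_sg_words: "finite (sg_words N m)"
proof -
  have "sg_words N m = {w. set w \<subseteq> {..<N} \<and> length w = m}" by (auto simp: sg_words_def)
  then show ?thesis by (simp add: finite_lists_length_eq)
qed

lemma sum_sg_words_Suc: "(\<Sum>w\<in>sg_words N (Suc m). g w) = (\<Sum>i<N. \<Sum>w\<in>sg_words N m. g (i # w))"
proof -
  have "bij_betw (\<lambda>(i, w). i # w) ({..<N} \<times> sg_words N m) (sg_words N (Suc m))"
  proof (rule bij_betwI')
    fix v assume "v \<in> sg_words N (Suc m)"
    then show "\<exists>x\<in>{..<N} \<times> sg_words N m. v = (case x of (i, w) \<Rightarrow> i # w)"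
      by (cases v) (auto simp: sg_words_def)
  qed (auto simp: sg_words_def)
  then have "(\<Sum>w\<in>sg_words N (Suc m). g w) = (\<Sum>(i,w)\<in>{..<N} \<times> sg_words N m. g (i # w))"
    by (subst sum.reindex_bij_betw[symmetric]) (auto simp: case_prod_unfold)
  then show ?thesis by (simp add: sum.cartesian_product)
qed

section \<open>Energies as sums over cells\<close>

lemma energy_level_eq:
  "sg_energy_level N p m u v = ((real N + 2) / real N) ^ m *
     (\<Sum>w\<in>sg_words N m. complete_form N (\<lambda>i. u (sg_word_map p w (p i))) (\<lambda>i. v (sg_word_map p w (p i))))"
proof -
  define T where "T = (SIGMA w:sg_words N m. {(i,j). i < N \<and> j < N \<and> i \<noteq> j})"
  define f where "f = (\<lambda>(w, i, j). (sg_word_map p w (p i), sg_word_map p w (p j)))"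
  define g where "g = (\<lambda>(x, y). (u x - u y) * (v x - v y))"
  have inj: "inj_on f T"
  proof (rule inj_onI, clarsimp simp: f_def T_def)
    fix w i j w' i' j'
    assume h: "w \<in> sg_words N m" "i < N" "j < N" "i \<noteq> j" "w' \<in> sg_words N m" "i' < N" "j' < N"
      "sg_word_map p w (p i) = sg_word_map p w' (p i')"
      "sg_word_map p w (p j) = sg_word_map p w' (p j')"
    have "w = w'"
      by (rule word_cells_share_two_points[of w w' "p i" "p i'" "p j" "p j'"])
        (use h in \<open>auto simp: sg_words_def vertex_in_K vertex_eq_iff\<close>)
    then show "w = w' \<and> i = i' \<and> j = j'" using h by (simp add: sg_word_map_inj vertex_eq_iff)
  qed
  have img: "f ` T = {(x, y). sg_adj N p m x y}"
  proof (rule set_eqI)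
    fix z
    show "z \<in> f ` T \<longleftrightarrow> z \<in> {(x, y). sg_adj N p m x y}"
    proof
      assume "z \<in> f ` T"
      then show "z \<in> {(x, y). sg_adj N p m x y}"
        by (auto simp: f_def T_def sg_adj_def sg_boundary_def sg_word_map_inj vertex_eq_iff)
    next
      assume "z \<in> {(x, y). sg_adj N p m x y}"
      then obtain w i j where "w \<in> sg_words N m" "i < N" "j < N" "i \<noteq> j"
        "z = (sg_word_map p w (p i), sg_word_map p w (p j))"
        by (auto simp: sg_adj_def sg_boundary_def)
      then show "z \<in> f ` T" by (intro image_eqI[of _ _ "(w, i, j)"]) (auto simp: f_def T_def)
    qed
  qed
  have fin: "finite {(i,j). i < N \<and> j < N \<and> i \<noteq> j}"
    by (rule finite_subset[of _ "{..<N} \<times> {..<N}"]) auto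
  have "(\<Sum>z\<in>{(x, y). sg_adj N p m x y}. g z) = (\<Sum>t\<in>T. g (f t))"
    unfolding img[symmetric] by (simp add: sum.reindex[OF inj])
  also have "\<dots> = (\<Sum>w\<in>sg_words N m. \<Sum>(i,j)\<in>{(i,j). i < N \<and> j < N \<and> i \<noteq> j}. g (f (w, i, j)))"
    unfolding T_def by (subst sum.Sigma) (use fin in \<open>auto simp: finite_sg_words case_prod_unfold\<close>)
  also have "\<dots> = (\<Sum>w\<in>sg_words N m. \<Sum>(i,j)\<in>{..<N}\<times>{..<N}. g (f (w, i, j)))"
    by (intro sum.cong refl sum.mono_neutral_left) (auto simp: f_def g_def)
  also have "\<dots> = (\<Sum>w\<in>sg_words N m.
      2 * complete_form N (\<lambda>i. u (sg_word_map p w (p i))) (\<lambda>i. v (sg_word_map p w (p i))))"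
    by (intro sum.cong refl)
      (simp add: complete_form_def sum.cartesian_product f_def g_def case_prod_unfold)
  finally show ?thesis
    unfolding sg_energy_level_def g_def[symmetric] sum_distrib_left[symmetric] by simp
qed

lemma energy_level_0: "sg_energy_level N p 0 u v = complete_form N (u \<circ> p) (v \<circ> p)"
proof -
  have "sg_words N 0 = {[]}" by (auto simp: sg_words_def)
  then show ?thesis by (simp add: energy_level_eq o_def)
qed

lemma energy_level_Suc:
  "sg_energy_level N p (Suc m) u v =
     (real N + 2) / real N * (\<Sum>i<N. sg_energy_level N p m (u \<circ> sg_map p i) (v \<circ> sg_map p i))"
  unfolding energy_level_eq sum_sg_words_Suc by (simp add: sum_distrib_left mult_ac)

lemma energy_level_commute: "sg_energy_level N p m u v = sg_energy_level N p m v u"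
  unfolding energy_level_eq by (simp add: complete_form_commute)

lemma energy_level_nonneg: "0 \<le> sg_energy_level N p m u u"
  unfolding energy_level_eq by (intro mult_nonneg_nonneg sum_nonneg complete_form_nonneg) auto

lemma energy_level_diff:
  "sg_energy_level N p m (\<lambda>x. u x - u' x) v = sg_energy_level N p m u v - sg_energy_level N p m u' v"
  unfolding energy_level_eq complete_form_diff_left by (simp add: sum_subtractf right_diff_distrib)

lemma energy_level_square_diff:
  "sg_energy_level N p m (\<lambda>x. u x - v x) (\<lambda>x. u x - v x)
    = sg_energy_level N p m u u - 2 * sg_energy_level N p m v u + sg_energy_level N p m v v"
  unfolding energy_level_diff
  by (simp add: energy_level_commute[of _ _ "\<lambda>x. u x - v x"] energy_level_diff
      energy_level_commute[of m u v])

end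

section \<open>Harmonic functions\<close>

lemma ext_step_cong:
  assumes "i < N" "j < N" "\<And>k. k < N \<Longrightarrow> a k = b k"
  shows "ext_step N i a j = ext_step N i b j"
  using assms by (simp add: ext_step_def)

lemma ext_step_commute: "ext_step N i a j = ext_step N j a i"
  by (simp add: ext_step_def add.commute)

lemma ext_step_diff: "ext_step N i (\<lambda>k. a k - b k) j = ext_step N i a j - ext_step N i b j"
  by (simp add: ext_step_def sum_subtractf diff_divide_distrib add_divide_distrib)

lemma ext_step_scale: "ext_step N i (\<lambda>k. c * a k) j = c * ext_step N i a j"
  by (simp add: ext_step_def sum_distrib_left[symmetric] distrib_left)

lemma ext_step_const: "ext_step N i (\<lambda>k. c) j = c"
  by (simp add: ext_step_def field_simps)

lemma ext_step_mono:
  assumes "i < N" "j < N" "\<And>k. k < N \<Longrightarrow> a k \<le> b k"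
  shows "ext_step N i a j \<le> ext_step N i b j"
proof -
  have "sum a {..<N} \<le> sum b {..<N}" by (intro sum_mono assms(3)) auto
  then show ?thesis
    using assms(3)[OF assms(1)] assms(3)[OF assms(2)] by (simp add: ext_step_def divide_right_mono)
qed

context gasket
begin

text \<open>
  \<open>glue g\<close> is the function that equals \<open>g i \<circ> F\<^sub>i\<^bsup>-1\<^esup>\<close> on the cell \<open>F\<^sub>i K\<close>. At a common point of two cells an
  arbitrary choice is made, harmless when the pieces agree there: \<open>g i (p\<^sub>j) = g j (p\<^sub>i)\<close>.
\<close>

definition cell_index :: "'a \<Rightarrow> nat" where
  "cell_index x = (SOME i. i < N \<and> x \<in> sg_map p i ` K)"

definition glue :: "(nat \<Rightarrow> 'a \<Rightarrow> real) \<Rightarrow> 'a \<Rightarrow> real" where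
  "glue g x = g (cell_index x) (2 *\<^sub>R x - p (cell_index x))"

lemma sg_map_inverse: "2 *\<^sub>R sg_map p i x - p i = x"
  by (simp add: sg_map_eq)

lemma glue_cell:
  assumes compat: "\<And>i j. i < N \<Longrightarrow> j < N \<Longrightarrow> g i (p j) = g j (p i)"
    and i: "i < N" and x: "x \<in> K"
  shows "glue g (sg_map p i x) = g i x"
proof -
  define k where "k = cell_index (sg_map p i x)"
  have "k < N \<and> sg_map p i x \<in> sg_map p k ` K"
    unfolding k_def cell_index_def by (rule someI[of _ i]) (use i x in auto)
  then obtain y where k: "k < N" and y: "y \<in> K" "sg_map p i x = sg_map p k y" by auto
  have "2 *\<^sub>R sg_map p i x - p k = y" by (simp add: y(2) sg_map_inverse)
  then have "glue g (sg_map p i x) = g k y" by (simp add: glue_def k_def)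
  also have "\<dots> = g i x"
  proof (cases "i = k")
    case True
    then show ?thesis using y by (simp add: sg_map_inj)
  next
    case False
    then show ?thesis using cells_meet[OF x y(1) i k False y(2)] compat[OF i k] by simp
  qed
  finally show ?thesis .
qed

lemma continuous_on_glue:
  assumes compat: "\<And>i j. i < N \<Longrightarrow> j < N \<Longrightarrow> g i (p j) = g j (p i)"
    and cont: "\<And>i. i < N \<Longrightarrow> continuous_on K (g i)"
  shows "continuous_on K (glue g)"
proof -
  have "continuous_on (sg_map p i ` K) (glue g)" if i: "i < N" for i
  proof -
    have "continuous_on (sg_map p i ` K) (\<lambda>y. g i (2 *\<^sub>R y - p i))"
      by (rule continuous_on_compose2[OF cont[OF i]])
        (auto intro!: continuous_intros simp: sg_map_inverse)
    then show ?thesis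
      by (rule continuous_on_eq) (auto simp: sg_map_inverse glue_cell[where g = g, OF compat] i)
  qed
  then have "continuous_on (\<Union>i\<in>{..<N}. sg_map p i ` K) (glue g)"
    by (intro continuous_on_closed_Union compact_imp_closed compact_continuous_image
        continuous_on_sg_map compact_K) auto
  then show ?thesis using K_eq by simp
qed

text \<open>
  The harmonic function with given vertex values is obtained by extending the values to the
  vertices of level \<open>m\<close> through the matrices \<open>ext_step\<close>, interpolating affinely inside the cells of
  level \<open>m\<close>, and letting \<open>m\<close> tend to infinity.
\<close>

primrec harm_approx :: "nat \<Rightarrow> (nat \<Rightarrow> real) \<Rightarrow> 'a \<Rightarrow> real" where
  "harm_approx 0 a = (\<lambda>x. \<Sum>i<N. a i * bary i x)"
| "harm_approx (Suc m) a = glue (\<lambda>i. harm_approx m (ext_step N i a))"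

lemma harm_approx_vertex: "j < N \<Longrightarrow> harm_approx m a (p j) = a j"
proof (induction m arbitrary: a j)
  case 0
  have "(\<Sum>i<N. a i * bary i (p j)) = (\<Sum>i<N. if i = j then a j else 0)"
    by (intro sum.cong refl) (use 0 bary_vertex in auto)
  then show ?case using 0 by simp
next
  case (Suc m)
  have "glue (\<lambda>i. harm_approx m (ext_step N i a)) (sg_map p j (p j)) = harm_approx m (ext_step N j a) (p j)"
    by (rule glue_cell) (use Suc in \<open>auto simp: ext_step_commute vertex_in_K\<close>)
  then show ?case using Suc by (simp add: sg_map_vertex ext_step_def)
qed

lemma harm_approx_cell:
  "i < N \<Longrightarrow> x \<in> K \<Longrightarrow> harm_approx (Suc m) a (sg_map p i x) = harm_approx m (ext_step N i a) x"
  by (simp add: glue_cell harm_approx_vertex ext_step_commute)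

lemma continuous_on_harm_approx: "continuous_on K (harm_approx m a)"
proof (induction m arbitrary: a)
  case 0
  show ?case by (simp, intro continuous_intros continuous_on_bary)
next
  case (Suc m)
  then show ?case
    by (simp, intro continuous_on_glue) (auto simp: harm_approx_vertex ext_step_commute)
qed

lemma harm_approx_bounds:
  assumes "x \<in> K" "\<And>j. j < N \<Longrightarrow> lo \<le> a j" "\<And>j. j < N \<Longrightarrow> a j \<le> hi"
  shows "lo \<le> harm_approx m a x \<and> harm_approx m a x \<le> hi"
  using assms
proof (induction m arbitrary: a x)
  case 0
  have "(\<Sum>i<N. lo * bary i x) \<le> (\<Sum>i<N. a i * bary i x)"
       "(\<Sum>i<N. a i * bary i x) \<le> (\<Sum>i<N. hi * bary i x)"
    by (intro sum_mono mult_right_mono; use 0 bary_nonneg in auto)+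
  then show ?case by (simp add: sum_bary flip: sum_distrib_left)
next
  case (Suc m)
  obtain i y where y: "i < N" "y \<in> K" "x = sg_map p i y" using K_cases[OF Suc.prems(1)] .
  have "lo \<le> ext_step N i a j" if "j < N" for j
    using ext_step_mono[OF y(1) that, of "\<lambda>_. lo" a] Suc.prems by (simp add: ext_step_const)
  moreover have "ext_step N i a j \<le> hi" if "j < N" for j
    using ext_step_mono[OF y(1) that, of a "\<lambda>_. hi"] Suc.prems by (simp add: ext_step_const)
  ultimately show ?case
    using Suc.IH[OF y(2)] unfolding y(3) harm_approx_cell[OF y(1,2)] by blast
qed

text \<open>
  On a cell of level \<open>n\<close> both approximants stay within the range of the vertex values of that cell,
  and \<open>n\<close> applications of \<open>ext_step\<close> have shrunk that range by the factor \<open>(N/(N + 2))^n\<close>.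
\<close>

lemma harm_approx_Cauchy:
  assumes "x \<in> K" "\<And>j k. j < N \<Longrightarrow> k < N \<Longrightarrow> \<bar>a j - a k\<bar> \<le> c"
  shows "\<bar>harm_approx (n + m) a x - harm_approx n a x\<bar> \<le> (real N / (real N + 2)) ^ n * (2 * c)"
  using assms
proof (induction n arbitrary: a x c)
  case 0
  have N: "0 < N" using N_ge_3 by simp
  have a: "a 0 - c \<le> a j" "a j \<le> a 0 + c" if "j < N" for j using 0(2)[OF that N] by auto
  have "a 0 - c \<le> harm_approx m a x \<and> harm_approx m a x \<le> a 0 + c" for m
    by (rule harm_approx_bounds[OF 0(1)]) (use a in auto)
  from this[of m] this[of 0] have "\<bar>harm_approx m a x - harm_approx 0 a x\<bar> \<le> 2 * c"
    by linarith
  then show ?case by (simp del: harm_approx.simps)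
next
  case (Suc n)
  obtain i y where y: "i < N" "y \<in> K" "x = sg_map p i y" using K_cases[OF Suc.prems(1)] .
  have "\<bar>harm_approx (n + m) (ext_step N i a) y - harm_approx n (ext_step N i a) y\<bar>
      \<le> (real N / (real N + 2)) ^ n * (2 * (real N / (real N + 2) * c))"
    by (rule Suc.IH[OF y(2)]) (intro ext_step_contracts y(1) Suc.prems)
  then show ?case
    unfolding y(3) add_Suc harm_approx_cell[OF y(1,2)] by (simp add: mult_ac)
qed

definition harm :: "(nat \<Rightarrow> real) \<Rightarrow> 'a \<Rightarrow> real" where
  "harm a x = lim (\<lambda>m. harm_approx m a x)"

lemma uniform_limit_harm: "uniform_limit K (\<lambda>m. harm_approx m a) (harm a) sequentially"
proof -
  let ?q = "real N / (real N + 2)"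
  obtain c where c: "\<And>j k. j < N \<Longrightarrow> k < N \<Longrightarrow> \<bar>a j - a k\<bar> \<le> c"
  proof
    fix j k assume "j < N" "k < N"
    then show "\<bar>a j - a k\<bar> \<le> sqrt (complete_form N a a)" by (rule diff_le_sqrt_complete_form)
  qed
  have q: "(\<lambda>n. ?q ^ n * (2 * c)) \<longlonglongrightarrow> 0 * (2 * c)"
    by (intro tendsto_intros LIMSEQ_realpow_zero) auto
  have "uniformly_Cauchy_on K (\<lambda>m. harm_approx m a)"
  proof (rule uniformly_Cauchy_onI)
    fix e :: real assume "e > 0"
    then have "\<forall>\<^sub>F n in sequentially. ?q ^ n * (2 * c) < e / 2"
      using order_tendstoD(2)[OF q, of "e / 2"] by simp
    then obtain M where M: "?q ^ M * (2 * c) < e / 2"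
      by (auto simp: eventually_sequentially)
    have "dist (harm_approx m a x) (harm_approx n a x) < e" if "x \<in> K" "m \<ge> M" "n \<ge> M" for x m n
    proof -
      have *: "\<bar>harm_approx l a x - harm_approx M a x\<bar> < e / 2" if "l \<ge> M" for l
        using harm_approx_Cauchy[of x a c M "l - M"] c \<open>x \<in> K\<close> M that by (simp del: harm_approx.simps)
      from *[OF that(2)] *[OF that(3)] show ?thesis unfolding dist_real_def by linarith
    qed
    then show "\<exists>M. \<forall>x\<in>K. \<forall>m\<ge>M. \<forall>n\<ge>M. dist (harm_approx m a x) (harm_approx n a x) < e" by blast
  qed
  then have "uniformly_convergent_on K (\<lambda>m. harm_approx m a)"
    by (rule Cauchy_uniformly_convergent)
  then show ?thesis
    unfolding uniformly_convergent_uniform_limit_iff harm_def[abs_def] .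
qed

lemma harm_tendsto: "x \<in> K \<Longrightarrow> (\<lambda>m. harm_approx m a x) \<longlonglongrightarrow> harm a x"
  using tendsto_uniform_limitI[OF uniform_limit_harm] .

lemma continuous_on_harm: "continuous_on K (harm a)"
  by (rule uniform_limit_theorem[OF _ uniform_limit_harm]) (auto simp: continuous_on_harm_approx)

lemma harm_vertex: "j < N \<Longrightarrow> harm a (p j) = a j"
  using harm_tendsto[OF vertex_in_K, of j a] by (simp add: harm_approx_vertex LIMSEQ_const_iff)

lemma harm_cell:
  assumes "i < N" "x \<in> K"
  shows "harm a (sg_map p i x) = harm (ext_step N i a) x"
proof -
  have "(\<lambda>m. harm_approx (Suc m) a (sg_map p i x)) \<longlonglongrightarrow> harm a (sg_map p i x)"
    using harm_tendsto[OF sg_map_in_K[OF assms]] by (rule LIMSEQ_Suc)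
  then have "(\<lambda>m. harm_approx m (ext_step N i a) x) \<longlonglongrightarrow> harm a (sg_map p i x)"
    unfolding harm_approx_cell[OF assms] .
  then show ?thesis using harm_tendsto[OF assms(2)] by (rule LIMSEQ_unique)
qed

lemma harm_bounds:
  assumes "x \<in> K" "\<And>j. j < N \<Longrightarrow> lo \<le> a j" "\<And>j. j < N \<Longrightarrow> a j \<le> hi"
  shows "lo \<le> harm a x" "harm a x \<le> hi"
  using LIMSEQ_le_const[OF harm_tendsto[OF assms(1)]] LIMSEQ_le_const2[OF harm_tendsto[OF assms(1)]]
    harm_approx_bounds[of x lo a hi] assms by blast+

text \<open>
  A working form of harmonicity. Unlike the minimising property it is visibly linear and stable
  under composition with the maps \<open>F\<^sub>w\<close>; the two notions are shown to coincide in
  \<open>harmonic_fun_iff\<close>.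
\<close>

definition locally_harmonic :: "('a \<Rightarrow> real) \<Rightarrow> bool" where
  "locally_harmonic h \<longleftrightarrow> continuous_on K h \<and>
     (\<forall>w i j. set w \<subseteq> {..<N} \<longrightarrow> i < N \<longrightarrow> j < N \<longrightarrow>
       h (sg_word_map p w (sg_map p i (p j))) = ext_step N i (\<lambda>k. h (sg_word_map p w (p k))) j)"

lemma locally_harmonic_harm: "locally_harmonic (harm a)"
  unfolding locally_harmonic_def
proof (intro conjI allI impI)
  fix w i j assume "set w \<subseteq> {..<N}" and i: "i < N" and j: "j < N"
  then show "harm a (sg_word_map p w (sg_map p i (p j)))
      = ext_step N i (\<lambda>k. harm a (sg_word_map p w (p k))) j"
  proof (induction w arbitrary: a)
    case Nil
    then have "harm a (sg_map p i (p j)) = ext_step N i a j"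
      by (simp add: harm_cell vertex_in_K harm_vertex)
    also have "\<dots> = ext_step N i (\<lambda>k. harm a (p k)) j"
      by (intro ext_step_cong i j) (simp add: harm_vertex)
    finally show ?case by simp
  next
    case (Cons l w)
    have w: "l < N" "set w \<subseteq> {..<N}" using Cons.prems by auto
    have "harm a (sg_map p l (sg_word_map p w (sg_map p i (p j))))
        = harm (ext_step N l a) (sg_word_map p w (sg_map p i (p j)))"
      by (intro harm_cell sg_word_map_in_K sg_map_in_K vertex_in_K i j w)
    also have "\<dots> = ext_step N i (\<lambda>k. harm (ext_step N l a) (sg_word_map p w (p k))) j"
      by (rule Cons.IH[OF w(2) i j])
    also have "\<dots> = ext_step N i (\<lambda>k. harm a (sg_map p l (sg_word_map p w (p k)))) j"
      by (intro ext_step_cong i j harm_cell[symmetric] sg_word_map_in_K vertex_in_K w)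
    finally show ?case by simp
  qed
qed (rule continuous_on_harm)

lemma locally_harmonicD:
  assumes "locally_harmonic h" "set w \<subseteq> {..<N}" "i < N" "j < N"
  shows "h (sg_word_map p w (sg_map p i (p j))) = ext_step N i (\<lambda>k. h (sg_word_map p w (p k))) j"
  using assms unfolding locally_harmonic_def by simp

lemma locally_harmonic_continuous: "locally_harmonic h \<Longrightarrow> continuous_on K h"
  unfolding locally_harmonic_def by simp

lemma locally_harmonic_step:
  assumes "locally_harmonic h" "i < N" "j < N"
  shows "h (sg_map p i (p j)) = ext_step N i (h \<circ> p) j"
  using locally_harmonicD[OF assms(1), of "[]"] assms(2,3) by (simp add: o_def)

lemma continuous_on_comp_sg_word_map:
  assumes "continuous_on K f" "set w \<subseteq> {..<N}"
  shows "continuous_on K (f \<circ> sg_word_map p w)"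
proof (rule continuous_on_compose[OF continuous_on_sg_word_map])
  have "sg_word_map p w ` K \<subseteq> K" using sg_word_map_in_K[OF assms(2)] by auto
  then show "continuous_on (sg_word_map p w ` K) f" by (rule continuous_on_subset[OF assms(1)])
qed

lemma locally_harmonic_comp:
  assumes "locally_harmonic h" "set v \<subseteq> {..<N}"
  shows "locally_harmonic (h \<circ> sg_word_map p v)"
  unfolding locally_harmonic_def
proof (intro conjI allI impI)
  fix w i j assume "set w \<subseteq> {..<N}" "i < N" "j < N"
  then have "h (sg_word_map p (v @ w) (sg_map p i (p j)))
      = ext_step N i (\<lambda>k. h (sg_word_map p (v @ w) (p k))) j"
    using assms by (intro locally_harmonicD) auto
  then show "(h \<circ> sg_word_map p v) (sg_word_map p w (sg_map p i (p j)))
      = ext_step N i (\<lambda>k. (h \<circ> sg_word_map p v) (sg_word_map p w (p k))) j"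
    by (simp add: sg_word_map_append)
qed (intro continuous_on_comp_sg_word_map locally_harmonic_continuous assms)

lemma locally_harmonic_comp_sg_map:
  "locally_harmonic h \<Longrightarrow> i < N \<Longrightarrow> locally_harmonic (h \<circ> sg_map p i)"
  using locally_harmonic_comp[of h "[i]"] by simp

lemma locally_harmonic_diff:
  "locally_harmonic h \<Longrightarrow> locally_harmonic k \<Longrightarrow> locally_harmonic (\<lambda>x. h x - k x)"
  unfolding locally_harmonic_def by (auto simp: ext_step_diff intro!: continuous_intros)

lemma locally_harmonic_scale:
  "locally_harmonic h \<Longrightarrow> locally_harmonic (\<lambda>x. c * h x)"
  unfolding locally_harmonic_def by (auto simp: ext_step_scale intro!: continuous_intros)

text \<open>
  The points \<open>F\<^sub>w(p\<^sub>0)\<close> are dense, because cells of level \<open>n\<close> have diameter proportional to \<open>2^-n\<close>.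
\<close>

lemma zero_on_vertices_imp_zero:
  assumes f: "continuous_on K f" and x: "x \<in> K"
    and zero: "\<And>w. set w \<subseteq> {..<N} \<Longrightarrow> f (sg_word_map p w (p 0)) = (0::real)"
  shows "f x = 0"
proof -
  have N: "0 < N" using N_ge_3 by simp
  define R where "R n v \<longleftrightarrow> length (fst v) = n \<and> set (fst v) \<subseteq> {..<N} \<and> snd v \<in> K
    \<and> x = sg_word_map p (fst v) (snd v)" for n and v :: "nat list \<times> 'a"
  have "\<exists>v. R n v" for n
  proof (rule K_word_cases[OF x, of n])
    fix w y assume "length w = n" "set w \<subseteq> {..<N}" "y \<in> K" "x = sg_word_map p w y"
    then show "\<exists>v. R n v" by (intro exI[of _ "(w, y)"]) (simp add: R_def)
  qed
  then have "\<forall>n. \<exists>v. R n v" by (rule allI)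
  from choice[OF this] obtain v where v: "\<forall>n. R n (v n)" by (rule exE)
  define w where "w n = fst (v n)" for n
  define y where "y n = snd (v n)" for n
  have W: "length (w n) = n \<and> set (w n) \<subseteq> {..<N} \<and> y n \<in> K \<and> x = sg_word_map p (w n) (y n)" for n
    using v unfolding R_def w_def y_def by (rule spec)
  note w = W[THEN conjunct1] W[THEN conjunct2, THEN conjunct1]
    W[THEN conjunct2, THEN conjunct2, THEN conjunct1] W[THEN conjunct2, THEN conjunct2, THEN conjunct2]
  define z where "z n = sg_word_map p (w n) (p 0)" for n
  have "\<exists>D. \<forall>a\<in>K. \<forall>b\<in>K. dist a b \<le> D"
    using compact_imp_bounded[OF compact_K] unfolding bounded_two_points .
  then obtain D where D: "\<And>a b. a \<in> K \<Longrightarrow> b \<in> K \<Longrightarrow> dist a b \<le> D" by blast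
  have "dist (z n) x \<le> (1/2)^n * D" for n
  proof -
    have "dist (z n) (sg_word_map p (w n) (y n)) = (1/2)^n * dist (p 0) (y n)"
      unfolding z_def dist_sg_word_map w(1) ..
    then have "dist (z n) x = (1/2)^n * dist (p 0) (y n)"
      unfolding w(4)[of n, symmetric] .
    also have "\<dots> \<le> (1/2)^n * D"
      by (rule mult_left_mono[OF D[OF vertex_in_K[OF N] w(3)]]) simp
    finally show ?thesis .
  qed
  note le = this
  have lim: "(\<lambda>n. (1/2)^n * D) \<longlonglongrightarrow> 0"
    using tendsto_mult_left_zero[OF LIMSEQ_realpow_zero[of "1/2"], of D] by simp
  have "(\<lambda>n. dist (z n) x) \<longlonglongrightarrow> 0"
  proof (rule tendsto_sandwich[OF _ _ tendsto_const lim])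
    show "\<forall>\<^sub>F n in sequentially. dist (z n) x \<le> (1/2)^n * D"
      by (rule always_eventually, rule allI, rule le)
  qed simp
  then have z: "z \<longlonglongrightarrow> x" unfolding tendsto_dist_iff[symmetric] .
  have "z n \<in> K" for n
    unfolding z_def by (intro sg_word_map_in_K vertex_in_K N w(2))
  then have "(\<lambda>n. f (z n)) \<longlonglongrightarrow> f x"
    by (intro continuous_on_tendsto_compose[OF f z x] always_eventually allI)
  moreover have "f (z n) = 0" for n unfolding z_def by (rule zero[OF w(2)])
  ultimately show ?thesis by (simp add: LIMSEQ_const_iff)
qed

lemma locally_harmonic_unique:
  assumes h: "locally_harmonic h" and x: "x \<in> K" and a: "\<And>j. j < N \<Longrightarrow> h (p j) = a j"
  shows "h x = harm a x"
proof -
  have *: "d (sg_word_map p w (p j)) = 0"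
    if "locally_harmonic d" "\<And>j. j < N \<Longrightarrow> d (p j) = 0" "set w \<subseteq> {..<N}" "j < N" for d w j
    using that
  proof (induction w arbitrary: d)
    case (Cons i w)
    have 0: "(d \<circ> sg_map p i) (p j) = 0" if "j < N" for j
    proof -
      have "d (sg_map p i (p j)) = ext_step N i (d \<circ> p) j"
        by (rule locally_harmonic_step) (use Cons.prems that in auto)
      also have "\<dots> = ext_step N i (\<lambda>_. 0) j"
        by (rule ext_step_cong) (use Cons.prems that in auto)
      finally show ?thesis by (simp add: ext_step_const)
    qed
    have "(d \<circ> sg_map p i) (sg_word_map p w (p j)) = 0"
      by (rule Cons.IH[OF locally_harmonic_comp_sg_map 0]) (use Cons.prems in auto)
    then show ?case by simp
  qed simp
  have "(\<lambda>x. h x - harm a x) x = 0"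
  proof (rule zero_on_vertices_imp_zero[OF _ x])
    have d: "locally_harmonic (\<lambda>x. h x - harm a x)"
      by (intro locally_harmonic_diff h locally_harmonic_harm)
    then show "continuous_on K (\<lambda>x. h x - harm a x)" by (simp add: locally_harmonic_def)
    show "h (sg_word_map p w (p 0)) - harm a (sg_word_map p w (p 0)) = 0" if "set w \<subseteq> {..<N}" for w
      by (rule *[OF d]) (use that a harm_vertex N_ge_3 in auto)
  qed
  then show ?thesis by simp
qed

text \<open>
  Induction over the level, each step being \<open>complete_form_ext_step\<close> with the symmetric array
  \<open>m i j = v (F\<^sub>i p\<^sub>j)\<close>.
\<close>

lemma energy_level_locally_harmonic:
  "locally_harmonic h \<Longrightarrow> sg_energy_level N p m h v = complete_form N (h \<circ> p) (v \<circ> p)"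
proof (induction m arbitrary: h v)
  case 0
  show ?case by (rule energy_level_0)
next
  case (Suc m)
  have "sg_energy_level N p (Suc m) h v = (real N + 2) / real N *
      (\<Sum>i<N. complete_form N (h \<circ> sg_map p i \<circ> p) (v \<circ> sg_map p i \<circ> p))"
    unfolding energy_level_Suc
    by (intro arg_cong2[of _ _ _ _ "(*)"] refl sum.cong Suc.IH locally_harmonic_comp_sg_map Suc.prems) auto
  also have "\<dots> = (real N + 2) / real N *
      (\<Sum>i<N. complete_form N (ext_step N i (h \<circ> p)) (\<lambda>j. v (sg_map p i (p j))))"
    by (intro arg_cong2[of _ _ _ _ "(*)"] refl sum.cong complete_form_cong)
      (auto simp: locally_harmonic_step[OF Suc.prems])
  also have "\<dots> = complete_form N (h \<circ> p) (\<lambda>i. v (sg_map p i (p i)))"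
    by (rule complete_form_ext_step) (use N_ge_3 sg_map_swap in \<open>auto simp: sg_map_swap\<close>)
  finally show ?case by (simp add: sg_map_vertex o_def)
qed

text \<open>
  Orthogonality: expand the nonnegative energy of \<open>v - h\<close>, where \<open>h\<close> is the harmonic function with the
  vertex values of \<open>v\<close>.
\<close>

lemma energy_level_lower: "complete_form N (v \<circ> p) (v \<circ> p) \<le> sg_energy_level N p m v v"
proof -
  let ?h = "harm (v \<circ> p)"
  have b: "complete_form N (?h \<circ> p) c = complete_form N (v \<circ> p) c" for c
    by (rule complete_form_cong) (auto simp: harm_vertex)
  have "0 \<le> sg_energy_level N p m (\<lambda>x. v x - ?h x) (\<lambda>x. v x - ?h x)"
    by (rule energy_level_nonneg)
  then show ?thesis
    unfolding energy_level_square_diff energy_level_locally_harmonic[OF locally_harmonic_harm]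
    by (simp add: b complete_form_commute[of _ "v \<circ> p" "?h \<circ> p"])
qed

text \<open>
  A minimiser \<open>h\<close> differs from the harmonic extension of its vertex values by a function \<open>d\<close> with
  vanishing energies and zero vertex values. Then \<open>d\<close> is constant on the vertices of each cell, and a
  cell of level \<open>n + 1\<close> has a vertex in common with the set of vertices of level \<open>n\<close>, so \<open>d\<close> vanishes
  at all vertices by induction.
\<close>

lemma harmonic_fun_iff: "h \<in> harmonic_fun N p K \<longleftrightarrow> locally_harmonic h"
proof
  assume h: "locally_harmonic h"
  have "complete_form N (h \<circ> p) (h \<circ> p) \<le> sg_energy_level N p n v v"
    if "\<forall>x\<in>sg_boundary N p. v x = h x" for n v
  proof -
    have "complete_form N (h \<circ> p) (h \<circ> p) = complete_form N (v \<circ> p) (v \<circ> p)"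
      by (rule complete_form_cong) (use that in \<open>auto simp: sg_boundary_def\<close>)
    then show ?thesis using energy_level_lower[of v n] by simp
  qed
  then show "h \<in> harmonic_fun N p K"
    using h by (auto simp: harmonic_fun_def sg_dom_def energy_level_locally_harmonic convergent_const
        locally_harmonic_def)
next
  assume h: "h \<in> harmonic_fun N p K"
  let ?k = "harm (h \<circ> p)"
  have cont: "continuous_on K h" using h by (auto simp: harmonic_fun_def sg_dom_def)
  have b: "complete_form N (?k \<circ> p) c = complete_form N (h \<circ> p) c" for c
    by (rule complete_form_cong) (auto simp: harm_vertex)
  define d where "d x = h x - ?k x" for x
  have E: "sg_energy_level N p n d d = 0" if "n \<ge> 1" for n
  proof -
    have "sg_energy_level N p n h h \<le> sg_energy_level N p n ?k ?k"
      using h that by (auto simp: harmonic_fun_def sg_boundary_def harm_vertex continuous_on_harm)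
    then have "sg_energy_level N p n d d \<le> 0"
      unfolding d_def[abs_def] energy_level_square_diff
        energy_level_locally_harmonic[OF locally_harmonic_harm]
      by (simp add: b complete_form_commute[of _ "h \<circ> p" "?k \<circ> p"])
    then show ?thesis using energy_level_nonneg[of n d] by simp
  qed
  have cell: "d (sg_word_map p w (p i)) = d (sg_word_map p w (p j))"
    if w: "w \<in> sg_words N n" "n \<ge> 1" "i < N" "j < N" for w n i j
  proof -
    let ?Q = "\<lambda>w. complete_form N (\<lambda>i. d (sg_word_map p w (p i))) (\<lambda>i. d (sg_word_map p w (p i)))"
    have "(\<Sum>w\<in>sg_words N n. ?Q w) = 0"
      using E[OF w(2)] N_ge_3 unfolding energy_level_eq by simp
    then have "?Q w = 0"
      using w(1) by (subst (asm) sum_nonneg_eq_0_iff) (auto simp: complete_form_nonneg finite_sg_words)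
    then show ?thesis
      using diff_le_sqrt_complete_form[OF w(3,4), of "\<lambda>i. d (sg_word_map p w (p i))"] by simp
  qed
  have zero: "d (sg_word_map p w (p i)) = 0" if "set w \<subseteq> {..<N}" "i < N" for w i
    using that
  proof (induction w arbitrary: i rule: rev_induct)
    case Nil
    then show ?case by (simp add: d_def harm_vertex)
  next
    case (snoc j w)
    have "d (sg_word_map p (w @ [j]) (p i)) = d (sg_word_map p (w @ [j]) (p j))"
      by (rule cell[of _ "Suc (length w)"]) (use snoc.prems in \<open>auto simp: sg_words_def\<close>)
    also have "\<dots> = 0" using snoc by (simp add: sg_word_map_append sg_map_vertex)
    finally show ?case .
  qed
  have eq: "h x = ?k x" if "x \<in> K" for x
  proof -
    have "d x = 0"
      by (rule zero_on_vertices_imp_zero[OF _ that])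
        (use zero N_ge_3 in \<open>auto simp: d_def[abs_def] intro!: continuous_intros cont continuous_on_harm\<close>)
    then show ?thesis by (simp add: d_def)
  qed
  show "locally_harmonic h"
    unfolding locally_harmonic_def
  proof (intro conjI allI impI cont)
    fix w i j assume w: "set w \<subseteq> {..<N}" "i < N" "j < N"
    then have "h (sg_word_map p w (sg_map p i (p j))) = ?k (sg_word_map p w (sg_map p i (p j)))"
      by (intro eq sg_word_map_in_K sg_map_in_K vertex_in_K)
    also have "\<dots> = ext_step N i (\<lambda>k. ?k (sg_word_map p w (p k))) j"
      using locally_harmonic_harm w by (auto simp: locally_harmonic_def)
    also have "\<dots> = ext_step N i (\<lambda>k. h (sg_word_map p w (p k))) j"
      using w by (intro ext_step_cong eq[symmetric] sg_word_map_in_K vertex_in_K)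
    finally show "h (sg_word_map p w (sg_map p i (p j)))
      = ext_step N i (\<lambda>k. h (sg_word_map p w (p k))) j" .
  qed
qed

end

section \<open>Harmonic functions modulo constants\<close>

text \<open>
  For the differences \<open>d\<^sub>j = a\<^sub>j - a\<^sub>i\<close> the equation reads \<open>d\<^sub>j + \<Sum>d = (N + 2)(b\<^sub>j - b\<^sub>i)\<close> for \<open>j \<noteq> i\<close>; summing over
  \<open>j\<close> gives \<open>N \<Sum>d = (N + 2) e\<close> for the sum \<open>e\<close> of the \<open>b\<^sub>j - b\<^sub>i\<close>, and \<open>c\<^sub>j\<close> below is the solution \<open>d\<^sub>j\<close>.
\<close>

lemma ext_step_surj:
  assumes i: "i < N"
  shows "\<exists>a. \<forall>j<N. ext_step N i a j = b j"
proof -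
  define e where "e = (\<Sum>j<N. b j - b i)"
  define c where "c j = (real N + 2) * (b j - b i - e / real N)" for j
  define a where "a j = b i + (if j = i then 0 else c j)" for j
  have N: "real N > 0" using i by simp
  have "sum c {..<N} = (real N + 2) * (\<Sum>j<N. (b j - b i) - e / real N)"
    by (simp add: c_def sum_distrib_left)
  also have "\<dots> = 0" unfolding sum_subtractf e_def using N by (simp add: field_simps sum_subtractf)
  finally have c: "sum c {..<N} = 0" .
  have "sum a {..<N} = (\<Sum>j<N. b i + c j - (if j = i then c i else 0))"
    by (intro sum.cong) (auto simp: a_def)
  also have "\<dots> = real N * b i + sum c {..<N} - c i"
    using i by (simp add: sum.distrib sum_subtractf)
  also have "\<dots> = real N * b i + (real N + 2) * (e / real N)"
    unfolding c by (simp add: c_def)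
  finally have S: "sum a {..<N} = real N * b i + (real N + 2) * (e / real N)" .
  have "ext_step N i a j = b j" if "j \<noteq> i" for j
  proof -
    have "a i + a j + sum a {..<N} = (real N + 2) * b j"
      unfolding S using that by (simp add: a_def c_def algebra_simps)
    then show ?thesis using that by (simp add: ext_step_def)
  qed
  moreover have "ext_step N i a i = b i" by (simp add: ext_step_def a_def)
  ultimately show ?thesis by metis
qed

context gasket
begin

lemma harmonic_rel_iff:
  "(h, k) \<in> harmonic_rel N p K \<longleftrightarrow>
    locally_harmonic h \<and> locally_harmonic k \<and> (\<exists>c. \<forall>x\<in>K. h x - k x = c)"
  by (simp add: harmonic_rel_def harmonic_fun_iff)

lemma mem_hq_class_iff:
  "k \<in> hq_class N p K h \<longleftrightarrow> locally_harmonic h \<and> locally_harmonic k \<and> (\<exists>c. \<forall>x\<in>K. h x - k x = c)"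
  by (simp add: hq_class_def harmonic_rel_iff)

lemma hq_class_eqI:
  assumes "locally_harmonic h" "locally_harmonic k" "\<And>x. x \<in> K \<Longrightarrow> h x - k x = c"
  shows "hq_class N p K h = hq_class N p K k"
proof (rule set_eqI)
  fix l
  have "(\<exists>d. \<forall>x\<in>K. h x - l x = d) \<longleftrightarrow> (\<exists>d. \<forall>x\<in>K. k x - l x = d)"
  proof
    assume "\<exists>d. \<forall>x\<in>K. h x - l x = d"
    then obtain d where d: "\<forall>x\<in>K. h x - l x = d" ..
    have "k x - l x = d - c" if "x \<in> K" for x
      using d[rule_format, OF that] assms(3)[OF that] by linarith
    then show "\<exists>d. \<forall>x\<in>K. k x - l x = d" by (intro exI ballI)
  next
    assume "\<exists>d. \<forall>x\<in>K. k x - l x = d"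
    then obtain d where d: "\<forall>x\<in>K. k x - l x = d" ..
    have "h x - l x = d + c" if "x \<in> K" for x
      using d[rule_format, OF that] assms(3)[OF that] by linarith
    then show "\<exists>d. \<forall>x\<in>K. h x - l x = d" by (intro exI ballI)
  qed
  then show "l \<in> hq_class N p K h \<longleftrightarrow> l \<in> hq_class N p K k"
    using assms(1,2) by (simp add: mem_hq_class_iff)
qed

lemma hq_class_eqD:
  assumes "locally_harmonic h" "locally_harmonic k" "hq_class N p K h = hq_class N p K k"
  shows "\<exists>c. \<forall>x\<in>K. h x - k x = c"
proof -
  have "k \<in> hq_class N p K k" using assms(2) by (auto simp: mem_hq_class_iff)
  then have "k \<in> hq_class N p K h" unfolding assms(3) .
  then show ?thesis by (simp add: mem_hq_class_iff)
qed

lemma hq_rep_class: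
  assumes "locally_harmonic h"
  shows "locally_harmonic (hq_rep (hq_class N p K h))"
    and "\<exists>c. \<forall>x\<in>K. h x - hq_rep (hq_class N p K h) x = c"
proof -
  have "h \<in> hq_class N p K h" using assms by (auto simp: mem_hq_class_iff)
  then have "hq_rep (hq_class N p K h) \<in> hq_class N p K h"
    unfolding hq_rep_def by (rule someI[where P = "\<lambda>k. k \<in> hq_class N p K h"])
  then show "locally_harmonic (hq_rep (hq_class N p K h))"
    "\<exists>c. \<forall>x\<in>K. h x - hq_rep (hq_class N p K h) x = c"
    by (simp_all add: mem_hq_class_iff)
qed

lemma harmonic_quot_eq: "harmonic_quot N p K = hq_class N p K ` {h. locally_harmonic h}"
  unfolding harmonic_quot_def quotient_def hq_class_def by (auto simp: harmonic_fun_iff)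

text \<open>
  For harmonic \<open>h\<close> this is the norm of the class of \<open>h\<close> modulo constants, by \<open>hq_norm_class\<close>. All norm
  computations in the quotient are done with it, on representatives.
\<close>

definition boundary_norm :: "('a \<Rightarrow> real) \<Rightarrow> real" where
  "boundary_norm h = sqrt (complete_form N (h \<circ> p) (h \<circ> p))"

lemma boundary_norm_nonneg: "boundary_norm h \<ge> 0"
  by (simp add: boundary_norm_def complete_form_nonneg)

lemma boundary_norm_scale: "boundary_norm (\<lambda>x. c * h x) = \<bar>c\<bar> * boundary_norm h"
  unfolding boundary_norm_def using complete_form_scale[of N c "h \<circ> p"]
  by (simp add: o_def real_sqrt_mult)

lemma boundary_norm_cong:
  assumes "\<And>j. j < N \<Longrightarrow> h (p j) - k (p j) = c"
  shows "boundary_norm h = boundary_norm k"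
  unfolding boundary_norm_def
  by (rule arg_cong[of _ _ sqrt], rule complete_form_shift[of _ _ _ c]) (use assms in simp)

lemma hq_norm_class:
  assumes h: "locally_harmonic h"
  shows "hq_norm N p (hq_class N p K h) = boundary_norm h"
proof -
  let ?k = "hq_rep (hq_class N p K h)"
  obtain c where "\<forall>x\<in>K. h x - ?k x = c" using hq_rep_class(2)[OF h] ..
  then have "boundary_norm h = boundary_norm ?k"
    by (intro boundary_norm_cong[of _ _ c]) (simp add: vertex_in_K)
  moreover have "sg_energy N p ?k ?k = complete_form N (?k \<circ> p) (?k \<circ> p)"
    unfolding sg_energy_def energy_level_locally_harmonic[OF hq_rep_class(1)[OF h]] by simp
  ultimately show ?thesis by (simp add: hq_norm_def hq_inner_def boundary_norm_def)
qed

lemma hq_diff_class: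
  assumes h: "locally_harmonic h" and k: "locally_harmonic k"
  shows "hq_diff N p K (hq_class N p K h) (hq_class N p K k) = hq_class N p K (\<lambda>x. h x - k x)"
proof -
  obtain c where c: "\<forall>x\<in>K. h x - hq_rep (hq_class N p K h) x = c" using hq_rep_class(2)[OF h] ..
  obtain d where d: "\<forall>x\<in>K. k x - hq_rep (hq_class N p K k) x = d" using hq_rep_class(2)[OF k] ..
  show ?thesis
    unfolding hq_diff_def
  proof (rule hq_class_eqI[of _ _ "d - c"])
    fix x assume x: "x \<in> K"
    show "hq_rep (hq_class N p K h) x - hq_rep (hq_class N p K k) x - (h x - k x) = d - c"
      using c[rule_format, OF x] d[rule_format, OF x] by linarith
  qed (intro locally_harmonic_diff hq_rep_class h k)+
qed

lemma hq_map_class: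
  assumes h: "locally_harmonic h" and i: "i < N"
  shows "hq_map N p K i (hq_class N p K h) = hq_class N p K (h \<circ> sg_map p i)"
proof -
  obtain c where c: "\<forall>x\<in>K. h x - hq_rep (hq_class N p K h) x = c" using hq_rep_class(2)[OF h] ..
  have "(hq_rep (hq_class N p K h) \<circ> sg_map p i) x - (h \<circ> sg_map p i) x = - c" if "x \<in> K" for x
    using c[rule_format, OF sg_map_in_K[OF i that]] by simp
  then show ?thesis
    unfolding hq_map_def
    by (intro hq_class_eqI[of _ _ "- c"] locally_harmonic_comp_sg_map hq_rep_class h i)
qed

lemma hq_word_map_class:
  assumes "locally_harmonic h" "set w \<subseteq> {..<N}"
  shows "hq_word_map N p K w (hq_class N p K h) = hq_class N p K (h \<circ> sg_word_map p w)"
  using assms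
proof (induction w arbitrary: h)
  case (Cons i w)
  then have "hq_word_map N p K (i # w) (hq_class N p K h)
      = hq_word_map N p K w (hq_class N p K (h \<circ> sg_map p i))"
    by (simp add: hq_word_map_def hq_map_class)
  also have "\<dots> = hq_class N p K ((h \<circ> sg_map p i) \<circ> sg_word_map p w)"
    by (rule Cons.IH[OF locally_harmonic_comp_sg_map]) (use Cons.prems in auto)
  finally show ?case by (simp only: sg_word_map_Cons comp_assoc)
qed (simp add: hq_word_map_def)

lemma boundary_norm_step:
  assumes h: "locally_harmonic h" and i: "i < N"
  shows "boundary_norm h \<le> (real N + 2) * boundary_norm (h \<circ> sg_map p i)"
proof -
  have "complete_form N (ext_step N i (h \<circ> p)) (ext_step N i (h \<circ> p))
      = complete_form N (h \<circ> sg_map p i \<circ> p) (h \<circ> sg_map p i \<circ> p)"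
    by (rule complete_form_cong) (use locally_harmonic_step[OF h i] in auto)
  then have "complete_form N (h \<circ> p) (h \<circ> p)
      \<le> (real N + 2)\<^sup>2 * complete_form N (h \<circ> sg_map p i \<circ> p) (h \<circ> sg_map p i \<circ> p)"
    using complete_form_ext_step_lower[OF i, of "h \<circ> p"] by (simp only:)
  then have "boundary_norm h \<le> sqrt ((real N + 2)\<^sup>2 *
      complete_form N (h \<circ> sg_map p i \<circ> p) (h \<circ> sg_map p i \<circ> p))"
    unfolding boundary_norm_def by (rule real_sqrt_le_mono)
  then show ?thesis by (simp only: boundary_norm_def real_sqrt_mult real_sqrt_abs)
qed

lemma boundary_norm_word:
  assumes "locally_harmonic h" "set w \<subseteq> {..<N}"
  shows "boundary_norm h \<le> (real N + 2) ^ length w * boundary_norm (h \<circ> sg_word_map p w)"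
  using assms
proof (induction w arbitrary: h)
  case (Cons i w)
  have i: "i < N" "set w \<subseteq> {..<N}" using Cons.prems by auto
  have "boundary_norm h \<le> (real N + 2) * boundary_norm (h \<circ> sg_map p i)"
    by (rule boundary_norm_step) (use Cons.prems in auto)
  also have "\<dots> \<le> (real N + 2) * ((real N + 2) ^ length w * boundary_norm (h \<circ> sg_map p i \<circ> sg_word_map p w))"
    by (intro mult_left_mono Cons.IH locally_harmonic_comp_sg_map Cons.prems i) auto
  finally show ?case by (simp only: sg_word_map_Cons comp_assoc mult.assoc length_Cons power_Suc)
qed simp

text \<open>
  Surjectivity of the maps \<open>A\<^sub>w\<close>, one letter at a time.
\<close>

lemma locally_harmonic_lift:
  assumes "locally_harmonic k" "set w \<subseteq> {..<N}"
  shows "\<exists>h. locally_harmonic h \<and> (\<forall>x\<in>K. h (sg_word_map p w x) = k x)"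
  using assms
proof (induction w arbitrary: k)
  case (Cons i w)
  have i: "i < N" "set w \<subseteq> {..<N}" using Cons.prems by auto
  obtain g where g: "locally_harmonic g" "\<forall>x\<in>K. g (sg_word_map p w x) = k x"
    using Cons.IH[OF Cons.prems(1) i(2)] by blast
  obtain a where a: "\<forall>j<N. ext_step N i a j = g (p j)"
    using ext_step_surj[OF i(1), of "\<lambda>j. g (p j)"] ..
  have "harm a (sg_map p i x) = g x" if x: "x \<in> K" for x
  proof -
    have "harm a (sg_map p i x) = harm (ext_step N i a) x" by (rule harm_cell[OF i(1) x])
    also have "\<dots> = g x" by (rule locally_harmonic_unique[OF g(1) x, symmetric]) (use a in simp)
    finally show ?thesis .
  qed
  then have "\<forall>x\<in>K. harm a (sg_word_map p (i # w) x) = k x"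
    using g(2) sg_word_map_in_K[OF i(2)] by simp
  then show ?case using locally_harmonic_harm by blast
qed auto

lemma hq_class_lift:
  assumes "X \<in> harmonic_quot N p K" "set w \<subseteq> {..<N}"
  obtains h where "locally_harmonic h" "X = hq_class N p K (h \<circ> sg_word_map p w)"
proof -
  obtain k where k: "locally_harmonic k" "X = hq_class N p K k"
    using assms(1) unfolding harmonic_quot_eq by auto
  obtain h where h: "locally_harmonic h" "\<forall>x\<in>K. h (sg_word_map p w x) = k x"
    using locally_harmonic_lift[OF k(1) assms(2)] by auto
  have "hq_class N p K k = hq_class N p K (h \<circ> sg_word_map p w)"
    by (rule hq_class_eqI[of _ _ 0]) (use k h assms(2) locally_harmonic_comp in auto)
  then show ?thesis using that[OF h(1)] k(2) by simp
qed

lemma hq_word_inv_class: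
  assumes h: "locally_harmonic h" and w: "set w \<subseteq> {..<N}"
  shows "hq_word_inv N p K w (hq_class N p K (h \<circ> sg_word_map p w)) = hq_class N p K h"
proof -
  have "inj_on (hq_word_map N p K w) (harmonic_quot N p K)"
  proof (rule inj_onI)
    fix X Y assume "X \<in> harmonic_quot N p K" "Y \<in> harmonic_quot N p K"
      and eq: "hq_word_map N p K w X = hq_word_map N p K w Y"
    then obtain f g where f: "locally_harmonic f" "X = hq_class N p K f"
      and g: "locally_harmonic g" "Y = hq_class N p K g" unfolding harmonic_quot_eq by auto
    define d where "d = (\<lambda>x. f x - g x)"
    have d: "locally_harmonic d" unfolding d_def by (intro locally_harmonic_diff f g)
    have "hq_class N p K (f \<circ> sg_word_map p w) = hq_class N p K (g \<circ> sg_word_map p w)"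
      using eq unfolding f(2) g(2) hq_word_map_class[OF f(1) w] hq_word_map_class[OF g(1) w] .
    from hq_class_eqD[OF locally_harmonic_comp[OF f(1) w] locally_harmonic_comp[OF g(1) w] this]
    obtain c where c: "\<forall>x\<in>K. (f \<circ> sg_word_map p w) x - (g \<circ> sg_word_map p w) x = c" ..
    have "boundary_norm (d \<circ> sg_word_map p w) = boundary_norm (\<lambda>_. 0)"
    proof (rule boundary_norm_cong[of _ _ c])
      fix j assume "j < N"
      show "(d \<circ> sg_word_map p w) (p j) - 0 = c"
        using c[rule_format, OF vertex_in_K[OF \<open>j < N\<close>]] by (simp add: d_def)
    qed
    also have "\<dots> = 0" by (simp add: boundary_norm_def complete_form_def)
    finally have "boundary_norm d \<le> 0" using boundary_norm_word[OF d w] by simp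
    then have "boundary_norm d = 0" using boundary_norm_nonneg[of d] by simp
    then have "sqrt (complete_form N (d \<circ> p) (d \<circ> p)) = 0"
      unfolding boundary_norm_def .
    then have "d (p j) = d (p 0)" if "j < N" for j
      using diff_le_sqrt_complete_form[OF that, of 0 "d \<circ> p"] N_ge_3 by simp
    then have b: "d x = harm (\<lambda>_. d (p 0)) x" if "x \<in> K" for x
      by (intro locally_harmonic_unique[OF d that])
    have const: "d x = d (p 0)" if "x \<in> K" for x
    proof -
      have "d (p 0) \<le> harm (\<lambda>_. d (p 0)) x" "harm (\<lambda>_. d (p 0)) x \<le> d (p 0)"
        by (rule harm_bounds[OF that, where lo = "d (p 0)" and hi = "d (p 0)"]; simp)+
      then show ?thesis using b[OF that] by linarith
    qed
    show "X = Y" unfolding f(2) g(2)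
      by (rule hq_class_eqI[OF f(1) g(1), of "d (p 0)"]) (use const in \<open>simp add: d_def\<close>)
  qed
  moreover have "hq_class N p K h \<in> harmonic_quot N p K"
    using h by (auto simp: harmonic_quot_eq)
  ultimately show ?thesis
    unfolding hq_word_inv_def hq_word_map_class[OF h w, symmetric] by (rule inv_into_f_f)
qed

text \<open>
  The operator norm is a supremum of reals, so it is an upper bound only because the values are
  bounded; \<open>boundary_norm_word\<close> supplies the bound \<open>(N + 2)^|w|\<close>.
\<close>

lemma hq_opnorm_bound:
  assumes h: "locally_harmonic h" and w: "set w \<subseteq> {..<N}"
  shows "boundary_norm h \<le> hq_opnorm N p K (hq_word_inv N p K w) * boundary_norm (h \<circ> sg_word_map p w)"
proof (cases "boundary_norm (h \<circ> sg_word_map p w) = 0")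
  case True
  then show ?thesis using boundary_norm_word[OF h w] by simp
next
  case False
  let ?B = "{X \<in> harmonic_quot N p K. hq_norm N p X \<le> 1}"
  let ?T = "\<lambda>X. hq_norm N p (hq_word_inv N p K w X)"
  have T: "?T (hq_class N p K (k \<circ> sg_word_map p w)) = boundary_norm k" if "locally_harmonic k" for k
    using that by (simp add: hq_word_inv_class w hq_norm_class)
  have bdd: "bdd_above (?T ` ?B)"
  proof (rule bdd_aboveI2)
    fix X assume X: "X \<in> ?B"
    obtain k where k: "locally_harmonic k" "X = hq_class N p K (k \<circ> sg_word_map p w)"
      using X w by (auto elim: hq_class_lift)
    have "?T X \<le> (real N + 2) ^ length w * boundary_norm (k \<circ> sg_word_map p w)"
      unfolding k(2) T[OF k(1)] by (rule boundary_norm_word[OF k(1) w])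
    also have "boundary_norm (k \<circ> sg_word_map p w) \<le> 1"
      using X unfolding k(2) by (simp add: hq_norm_class locally_harmonic_comp k w)
    finally show "?T X \<le> (real N + 2) ^ length w" by (simp add: mult_left_mono)
  qed
  define s where "s = inverse (boundary_norm (h \<circ> sg_word_map p w))"
  have s: "s > 0" using False boundary_norm_nonneg[of "h \<circ> sg_word_map p w"] by (simp add: s_def)
  define k where "k = (\<lambda>x. s * h x)"
  have k: "locally_harmonic k" unfolding k_def by (rule locally_harmonic_scale[OF h])
  have "boundary_norm (k \<circ> sg_word_map p w) = s * boundary_norm (h \<circ> sg_word_map p w)"
    using boundary_norm_scale[of s "h \<circ> sg_word_map p w"] s by (simp add: k_def o_def)
  also have "\<dots> = 1" using False by (simp add: s_def)
  finally have "hq_class N p K (k \<circ> sg_word_map p w) \<in> ?B"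
    using k w by (auto simp: harmonic_quot_eq hq_norm_class locally_harmonic_comp)
  then have "?T (hq_class N p K (k \<circ> sg_word_map p w)) \<le> hq_opnorm N p K (hq_word_inv N p K w)"
    unfolding hq_opnorm_def by (rule cSUP_upper[OF _ bdd])
  then have "s * boundary_norm h \<le> hq_opnorm N p K (hq_word_inv N p K w)"
    using s boundary_norm_scale[of s h] unfolding T[OF k] by (simp add: k_def)
  then show ?thesis using s by (simp add: s_def field_simps)
qed

end

section \<open>Deviation from harmonicity\<close>

text \<open>
  Here \<open>m i j\<close> is the value at the midpoint of vertices \<open>i\<close> and \<open>j\<close> and \<open>m k k\<close> the value at vertex
  \<open>k\<close>. The error \<open>e\<close> against harmonic extension vanishes at the corners and has the same midpoint
  Laplacians as \<open>m\<close>, since harmonic extension has zero ones. A midpoint has \<open>2(N - 1)\<close> neighbours, of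
  which 2 are corners; where \<open>\<bar>e\<bar>\<close> is maximal the other \<open>2(N - 2)\<close> cannot compensate, and
  \<open>2 max \<bar>e\<bar> \<le> d\<close> follows.
\<close>

lemma discrete_maximum_principle:
  fixes m :: "nat \<Rightarrow> nat \<Rightarrow> real"
  assumes sym: "\<And>i j. i < N \<Longrightarrow> j < N \<Longrightarrow> m i j = m j i"
    and lap: "\<And>i j. i < N \<Longrightarrow> j < N \<Longrightarrow> i \<noteq> j \<Longrightarrow>
      \<bar>2 * real N * m i j - sum (m i) {..<N} - sum (m j) {..<N}\<bar> \<le> d"
    and d: "d \<ge> 0" and ij: "i < N" "j < N"
  shows "\<bar>m i j - ext_step N i (\<lambda>k. m k k) j\<bar> \<le> d / 2"
proof -
  define a where "a k = m k k" for k
  define e where "e i j = m i j - ext_step N i a j" for i j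
  have e_diag: "e i i = 0" for i by (simp add: e_def ext_step_def a_def)
  have e_sym: "e i j = e j i" if "i < N" "j < N" for i j
    using sym[OF that] by (simp add: e_def ext_step_def add.commute a_def)
  have e_lap: "\<bar>2 * real N * e i j - sum (e i) {..<N} - sum (e j) {..<N}\<bar> \<le> d"
    if "i < N" "j < N" "i \<noteq> j" for i j
  proof -
    have "2 * real N * ext_step N i a j - sum (ext_step N i a) {..<N} - sum (ext_step N j a) {..<N}
        = (real N * ext_step N i a j - sum (ext_step N i a) {..<N})
          + (real N * ext_step N j a i - sum (ext_step N j a) {..<N})"
      by (simp add: ext_step_def add.commute)
    also have "\<dots> = real N / (real N + 2) * ((a j - a i) + (a i - a j))"
      using that unfolding ext_step_laplacian[OF that(1,2)] ext_step_laplacian[OF that(2,1)]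
      by (simp only: distrib_left if_False) simp
    finally have "2 * real N * ext_step N i a j - sum (ext_step N i a) {..<N}
        - sum (ext_step N j a) {..<N} = 0" by simp
    then have "2 * real N * e i j - sum (e i) {..<N} - sum (e j) {..<N}
        = 2 * real N * m i j - sum (m i) {..<N} - sum (m j) {..<N}"
      unfolding e_def sum_subtractf right_diff_distrib by linarith
    then show ?thesis using lap[OF that] by simp
  qed
  define S where "S = (\<lambda>(i,j). \<bar>e i j\<bar>) ` ({..<N} \<times> {..<N})"
  have S: "finite S" "S \<noteq> {}" using ij by (auto simp: S_def)
  have le: "\<bar>e i j\<bar> \<le> Max S" if "i < N" "j < N" for i j
    using S(1) that by (intro Max_ge) (auto simp: S_def)
  have "Max S \<in> S" using S by (rule Max_in)
  then obtain k l where kl: "k < N" "l < N" "Max S = \<bar>e k l\<bar>" by (auto simp: S_def)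
  have "Max S \<le> d / 2"
  proof (cases "k = l")
    case True
    then show ?thesis using kl d by (simp add: e_diag)
  next
    case False
    define R where "R = {..<N} - {k, l}"
    have R: "{..<N} = insert k (insert l R)" "k \<notin> insert l R" "l \<notin> R" "finite R"
      using kl False by (auto simp: R_def)
    have "card {..<N} = Suc (Suc (card R))" unfolding R(1) using R by simp
    then have cR: "real N = real (card R) + 2" by simp
    have "sum (e k) {..<N} = e k l + sum (e k) R" "sum (e l) {..<N} = e k l + sum (e l) R"
      unfolding R(1) using R e_sym[OF kl(2,1)] by (simp_all add: e_diag)
    then have "\<bar>(2 * real N - 2) * e k l - sum (e k) R - sum (e l) R\<bar> \<le> d"
      using e_lap[OF kl(1,2) False] by (simp add: algebra_simps)
    moreover have s: "\<bar>sum (e q) R\<bar> \<le> real (card R) * Max S" if "q < N" for q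
    proof -
      have "\<bar>sum (e q) R\<bar> \<le> (\<Sum>r\<in>R. \<bar>e q r\<bar>)" by (rule sum_abs)
      also have "\<dots> \<le> (\<Sum>r\<in>R. Max S)" by (intro sum_mono le that) (auto simp: R_def)
      finally show ?thesis by simp
    qed
    moreover have "\<bar>(2 * real N - 2) * e k l\<bar> = (2 * real (card R) + 2) * Max S"
      unfolding kl(3) abs_mult cR by simp
    ultimately have "(2 * real (card R) + 2) * Max S \<le> d + 2 * (real (card R) * Max S)"
      using s[OF kl(1)] s[OF kl(2)] by linarith
    then show ?thesis by (simp add: algebra_simps)
  qed
  then show ?thesis using le[OF ij] unfolding e_def a_def[abs_def] by linarith
qed

context gasket
begin

lemma energy_level_cong:
  assumes "\<And>x. x \<in> K \<Longrightarrow> u x = u' x" "\<And>x. x \<in> K \<Longrightarrow> v x = v' x"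
  shows "sg_energy_level N p m u v = sg_energy_level N p m u' v'"
  unfolding energy_level_eq
  by (intro arg_cong2[of _ _ _ _ "(*)"] refl sum.cong complete_form_cong assms
      sg_word_map_in_K vertex_in_K) (auto simp: sg_words_def)

lemma energy_level_glue:
  assumes "\<And>i j. i < N \<Longrightarrow> j < N \<Longrightarrow> g i (p j) = g j (p i)"
  shows "sg_energy_level N p (Suc m) (glue g) v =
     (real N + 2) / real N * (\<Sum>l<N. sg_energy_level N p m (g l) (v \<circ> sg_map p l))"
  unfolding energy_level_Suc
  by (intro arg_cong2[of _ _ _ _ "(*)"] refl sum.cong energy_level_cong)
    (simp_all add: glue_cell[where g = g, OF assms])

lemma energy_level_zero: "sg_energy_level N p m (\<lambda>_. 0) v = 0"
  by (simp add: energy_level_eq complete_form_def)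

text \<open>
  Test functions: the tent that is 1 at the single midpoint \<open>F\<^sub>i p\<^sub>j = F\<^sub>j p\<^sub>i\<close>, 0 at all other vertices of
  level 1, and harmonic on every cell of level 1. A copy of it, scaled into the cell of a word \<open>w\<close>,
  is \<open>cell_spike w i j\<close> below.
\<close>

definition spike_piece :: "nat \<Rightarrow> nat \<Rightarrow> nat \<Rightarrow> 'a \<Rightarrow> real" where
  "spike_piece i j k = (if k = i then harm (\<lambda>l. if l = j then 1 else 0)
     else if k = j then harm (\<lambda>l. if l = i then 1 else 0) else (\<lambda>_. 0))"

lemma spike_piece_vertex:
  assumes "i \<noteq> j" "l < N"
  shows "spike_piece i j k (p l) = (if k = i \<and> l = j \<or> k = j \<and> l = i then 1 else 0)"
  using assms by (auto simp: spike_piece_def harm_vertex)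

lemma spike_piece_compat:
  assumes "i \<noteq> j" "k < N" "l < N"
  shows "spike_piece i j k (p l) = spike_piece i j l (p k)"
  using assms by (auto simp: spike_piece_vertex)

lemma energy_level_dirac:
  assumes "j < N"
  shows "sg_energy_level N p m (harm (\<lambda>l. if l = j then 1 else 0)) v
    = real N * v (p j) - (\<Sum>k<N. v (p k))"
proof -
  let ?d = "\<lambda>l. if l = j then 1 else 0 :: real"
  have "sg_energy_level N p m (harm ?d) v = complete_form N (harm ?d \<circ> p) (v \<circ> p)"
    by (rule energy_level_locally_harmonic[OF locally_harmonic_harm])
  also have "\<dots> = complete_form N ?d (v \<circ> p)"
    by (rule complete_form_cong) (auto simp: harm_vertex)
  also have "\<dots> = complete_form N (v \<circ> p) ?d" by (rule complete_form_commute)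
  also have "\<dots> = (\<Sum>l<N. if l = j then real N * v (p j) - (\<Sum>k<N. v (p k)) else 0)"
    unfolding complete_form_eq by (intro sum.cong refl) auto
  finally show ?thesis using assms by simp
qed

text \<open>
  The graph Laplacian at the midpoint of the \<open>i\<close>-th and \<open>j\<close>-th vertices of the cell of \<open>w\<close>, in the graph
  of level \<open>length w + 1\<close>: the midpoint occurs once in each sum, so that its net coefficient \<open>2N - 2\<close> is
  the number of its neighbours.
\<close>

definition midpoint_laplacian :: "('a \<Rightarrow> real) \<Rightarrow> nat list \<Rightarrow> nat \<Rightarrow> nat \<Rightarrow> real" where
  "midpoint_laplacian v w i j = 2 * real N * v (sg_word_map p w (sg_map p i (p j)))
     - (\<Sum>k<N. v (sg_word_map p w (sg_map p i (p k))))
     - (\<Sum>k<N. v (sg_word_map p w (sg_map p j (p k))))"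

primrec cell_spike :: "nat list \<Rightarrow> nat \<Rightarrow> nat \<Rightarrow> 'a \<Rightarrow> real" where
  "cell_spike [] i j = glue (spike_piece i j)"
| "cell_spike (k # w) i j = glue (\<lambda>l. if l = k then cell_spike w i j else (\<lambda>_. 0))"

lemma cell_spike_vertex:
  assumes "i < N" "j < N" "i \<noteq> j" "set w \<subseteq> {..<N}" "l < N"
  shows "cell_spike w i j (p l) = 0"
  using assms(4,5)
proof (induction w arbitrary: l)
  case Nil
  have "glue (spike_piece i j) (sg_map p l (p l)) = spike_piece i j l (p l)"
    by (rule glue_cell) (use assms(3) Nil in \<open>auto simp: vertex_in_K spike_piece_compat\<close>)
  then show ?case using Nil assms by (simp add: sg_map_vertex spike_piece_vertex)
next
  case (Cons k w)
  have IH: "cell_spike w i j (p l) = 0" if "l < N" for l using Cons that by simp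
  have "glue (\<lambda>l. if l = k then cell_spike w i j else (\<lambda>_. 0)) (sg_map p l (p l))
      = (if l = k then cell_spike w i j else (\<lambda>_. 0)) (p l)"
    by (rule glue_cell) (use Cons.prems in \<open>auto simp: vertex_in_K IH\<close>)
  then show ?case using Cons.prems by (simp add: sg_map_vertex IH)
qed

context
  fixes i j :: nat
  assumes i: "i < N" and j: "j < N" and ij: "i \<noteq> j"
begin

lemma cell_spike_Nil:
  assumes "k < N" "x \<in> K"
  shows "cell_spike [] i j (sg_map p k x) = spike_piece i j k x"
  unfolding cell_spike.simps
  by (rule glue_cell) (use assms spike_piece_compat[OF ij] in auto)

lemma cell_spike_Cons:
  assumes "l < N" "x \<in> K" "set w \<subseteq> {..<N}"
  shows "cell_spike (k # w) i j (sg_map p l x) = (if l = k then cell_spike w i j x else 0)"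
proof -
  have "cell_spike (k # w) i j (sg_map p l x) = (if l = k then cell_spike w i j else (\<lambda>_. 0)) x"
    unfolding cell_spike.simps
    by (rule glue_cell) (use assms in \<open>auto simp: cell_spike_vertex i j ij\<close>)
  then show ?thesis by simp
qed

lemma continuous_on_cell_spike: "set w \<subseteq> {..<N} \<Longrightarrow> continuous_on K (cell_spike w i j)"
proof (induction w)
  case Nil
  show ?case unfolding cell_spike.simps
    by (rule continuous_on_glue)
      (auto simp: spike_piece_compat ij, auto simp: spike_piece_def continuous_on_harm)
next
  case (Cons k w)
  then show ?case unfolding cell_spike.simps
    by (intro continuous_on_glue) (auto simp: cell_spike_vertex i j ij)
qed

lemma cell_spike_bounds:
  assumes "set w \<subseteq> {..<N}" "x \<in> K"
  shows "0 \<le> cell_spike w i j x \<and> cell_spike w i j x \<le> 1"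
  using assms
proof (induction w arbitrary: x)
  case Nil
  obtain k y where y: "k < N" "y \<in> K" "x = sg_map p k y" using K_cases[OF Nil(2)] .
  have "0 \<le> harm (\<lambda>l. if l = q then 1 else 0) y" "harm (\<lambda>l. if l = q then 1 else 0) y \<le> 1" for q
    by (rule harm_bounds[OF y(2), where lo = 0 and hi = 1]; simp)+
  then show ?case unfolding y(3) cell_spike_Nil[OF y(1,2)] by (auto simp: spike_piece_def)
next
  case (Cons k w)
  obtain l y where y: "l < N" "y \<in> K" "x = sg_map p l y" using K_cases[OF Cons.prems(2)] .
  have w: "set w \<subseteq> {..<N}" using Cons.prems by simp
  show ?case unfolding y(3) cell_spike_Cons[OF y(1,2) w] using Cons.IH[OF w y(2)] by auto
qed

lemma cell_spike_support:
  assumes "set w \<subseteq> {..<N}" "x \<in> K" "cell_spike w i j x \<noteq> 0"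
  shows "x \<in> sg_word_map p w ` K"
  using assms
proof (induction w arbitrary: x)
  case (Cons k w)
  obtain l y where y: "l < N" "y \<in> K" "x = sg_map p l y" using K_cases[OF Cons.prems(2)] .
  have w: "set w \<subseteq> {..<N}" using Cons.prems by simp
  have "l = k" "cell_spike w i j y \<noteq> 0"
    using Cons.prems(3) unfolding y(3) cell_spike_Cons[OF y(1,2) w] by (auto split: if_splits)
  then show ?case using Cons.IH[OF w y(2)] y(3) by auto
qed auto

text \<open>
  From the level at which the tent is piecewise harmonic onwards, its energy against \<open>v\<close> no longer
  depends on the level, so the limit defining the energy is this value.
\<close>

lemma energy_level_cell_spike:
  assumes "set w \<subseteq> {..<N}"
  shows "sg_energy_level N p (Suc (m + length w)) (cell_spike w i j) v =
    ((real N + 2) / real N) ^ Suc (length w) * midpoint_laplacian v w i j"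
  using assms
proof (induction w arbitrary: v)
  case Nil
  have "sg_energy_level N p (Suc m) (glue (spike_piece i j)) v = (real N + 2) / real N *
      (\<Sum>l<N. sg_energy_level N p m (spike_piece i j l) (v \<circ> sg_map p l))"
    by (rule energy_level_glue) (use spike_piece_compat[OF ij] in auto)
  also have "(\<Sum>l<N. sg_energy_level N p m (spike_piece i j l) (v \<circ> sg_map p l))
      = (\<Sum>l<N. (if l = i then real N * v (sg_map p i (p j)) - (\<Sum>k<N. v (sg_map p i (p k))) else 0)
             + (if l = j then real N * v (sg_map p j (p i)) - (\<Sum>k<N. v (sg_map p j (p k))) else 0))"
    by (intro sum.cong refl)
      (use ij i j in \<open>auto simp: spike_piece_def energy_level_dirac energy_level_zero\<close>)
  also have "\<dots> = 2 * real N * v (sg_map p i (p j)) - (\<Sum>k<N. v (sg_map p i (p k)))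
        - (\<Sum>k<N. v (sg_map p j (p k)))"
    using i j sg_map_swap[of j i] by (simp add: sum.distrib)
  finally show ?case by (simp add: midpoint_laplacian_def)
next
  case (Cons k w)
  have w: "k < N" "set w \<subseteq> {..<N}" using Cons.prems by auto
  have "sg_energy_level N p (Suc (Suc (m + length w))) (cell_spike (k # w) i j) v = (real N + 2) / real N *
      (\<Sum>l<N. sg_energy_level N p (Suc (m + length w)) (if l = k then cell_spike w i j else (\<lambda>_. 0)) (v \<circ> sg_map p l))"
    unfolding cell_spike.simps
    by (rule energy_level_glue) (use w in \<open>auto simp: cell_spike_vertex i j ij\<close>)
  also have "(\<Sum>l<N. sg_energy_level N p (Suc (m + length w)) (if l = k then cell_spike w i j else (\<lambda>_. 0)) (v \<circ> sg_map p l))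
     = (\<Sum>l<N. if l = k then sg_energy_level N p (Suc (m + length w)) (cell_spike w i j) (v \<circ> sg_map p k) else 0)"
    by (intro sum.cong refl) (auto simp: energy_level_zero)
  also have "\<dots> = sg_energy_level N p (Suc (m + length w)) (cell_spike w i j) (v \<circ> sg_map p k)"
    using w by simp
  finally show ?case unfolding Cons.IH[OF w(2)] by (simp add: midpoint_laplacian_def)
qed

lemma cell_spike_energy:
  assumes w: "set w \<subseteq> {..<N}"
  shows "cell_spike w i j \<in> sg_dom0 N p K"
    and "sg_energy N p u (cell_spike w i j) =
    ((real N + 2) / real N) ^ Suc (length w) * midpoint_laplacian u w i j"
proof -
  have lim: "(\<lambda>m. sg_energy_level N p m (cell_spike w i j) v) \<longlonglongrightarrow>
      ((real N + 2) / real N) ^ Suc (length w) * midpoint_laplacian v w i j" for v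
  proof (rule LIMSEQ_offset[of _ "Suc (length w)"])
    show "(\<lambda>m. sg_energy_level N p (m + Suc (length w)) (cell_spike w i j) v) \<longlonglongrightarrow>
      ((real N + 2) / real N) ^ Suc (length w) * midpoint_laplacian v w i j"
      unfolding add_Suc_right energy_level_cell_spike[OF w] by (rule tendsto_const)
  qed
  have "convergent (\<lambda>m. sg_energy_level N p m (cell_spike w i j) (cell_spike w i j))"
    using lim[of "cell_spike w i j"] unfolding convergent_def by blast
  then show "cell_spike w i j \<in> sg_dom0 N p K"
    using continuous_on_cell_spike[OF w] cell_spike_vertex[OF i j ij w]
    by (simp add: sg_dom0_def sg_dom_def sg_boundary_def)
  show "sg_energy N p u (cell_spike w i j) =
    ((real N + 2) / real N) ^ Suc (length w) * midpoint_laplacian u w i j"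
    unfolding sg_energy_def energy_level_commute[of _ u] by (rule limI[OF lim])
qed

end

lemma sg_word_cell_subset: "set w \<subseteq> {..<N} \<Longrightarrow> sg_word_map p w ` K \<subseteq> K"
  using sg_word_map_in_K by auto

lemma compact_subset_sets:
  assumes "is_standard_bernoulli N p K \<mu>" "compact A" "A \<subseteq> K"
  shows "A \<in> sets \<mu>"
proof -
  have "A \<in> sets (restrict_space borel K)"
    using borel_closed[OF compact_imp_closed[OF compact_K]] assms(3)
      borel_closed[OF compact_imp_closed[OF assms(2)]] by (subst sets_restrict_space_iff) auto
  then show ?thesis using assms(1) by (simp add: is_standard_bernoulli_def)
qed

lemma bernoulli_self_similar:
  assumes "is_standard_bernoulli N p K \<mu>" "A \<in> sets \<mu>"
  shows "measure \<mu> A = (1 / real N) * (\<Sum>i<N. measure \<mu> (sg_map p i -` A \<inter> K))"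
  using assms unfolding is_standard_bernoulli_def by blast

text \<open>
  Only \<open>F\<^sub>k\<close> maps a point of \<open>K\<close>, namely \<open>p\<^sub>k\<close>, to \<open>p\<^sub>k\<close>, so self-similarity makes the mass of \<open>p\<^sub>k\<close> equal to its
  \<open>N\<close>-th part.
\<close>

lemma measure_vertex:
  assumes \<mu>: "is_standard_bernoulli N p K \<mu>" and k: "k < N"
  shows "measure \<mu> {p k} = 0"
proof -
  have "sg_map p i -` {p k} \<inter> K = (if i = k then {p k} else {})" if "i < N" for i
  proof (cases "i = k")
    case True
    then show ?thesis using k sg_map_inj[of k _ "p k"] by (auto simp: sg_map_vertex vertex_in_K)
  next
    case False
    have "sg_map p i x \<noteq> p k" if "x \<in> K" for x
    proof
      assume "sg_map p i x = p k"
      then have "p k = p i"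
        using cells_meet(2)[OF \<open>x \<in> K\<close> vertex_in_K[OF k] \<open>i < N\<close> k False] by (simp add: sg_map_vertex)
      then show False using False k \<open>i < N\<close> by (simp add: vertex_eq_iff)
    qed
    then show ?thesis using False by auto
  qed
  then have "(\<Sum>i<N. measure \<mu> (sg_map p i -` {p k} \<inter> K)) = (\<Sum>i<N. if i = k then measure \<mu> {p k} else 0)"
    by (intro sum.cong) auto
  also have "\<dots> = measure \<mu> {p k}" using k by simp
  finally have "measure \<mu> {p k} = (1 / real N) * measure \<mu> {p k}"
    using bernoulli_self_similar[OF \<mu> compact_subset_sets[OF \<mu>, of "{p k}"]] vertex_in_K[OF k] by simp
  moreover have "1 / real N \<noteq> 1" using N_ge_3 by simp
  ultimately show ?thesis by (metis mult_cancel_right1)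
qed

text \<open>
  The preimage of a cell under a map with a different first letter is at most a single vertex, a
  null set.
\<close>

lemma measure_cell:
  assumes \<mu>: "is_standard_bernoulli N p K \<mu>"
  shows "set w \<subseteq> {..<N} \<Longrightarrow> measure \<mu> (sg_word_map p w ` K) \<le> (1 / real N) ^ length w"
proof (induction w)
  case Nil
  interpret prob_space \<mu> using \<mu> by (simp add: is_standard_bernoulli_def)
  show ?case by simp
next
  case (Cons k w)
  interpret prob_space \<mu> using \<mu> by (simp add: is_standard_bernoulli_def)
  have k: "k < N" and w: "set w \<subseteq> {..<N}" using Cons.prems by auto
  define A where "A = sg_word_map p w ` K"
  have A: "A \<subseteq> K" unfolding A_def by (rule sg_word_cell_subset[OF w])
  have sub: "sg_map p k ` A \<subseteq> K" using A sg_map_in_K[OF k] by auto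
  have "compact (sg_map p k ` A)" unfolding A_def
    by (intro compact_continuous_image continuous_on_sg_map continuous_on_sg_word_map compact_K)
  from compact_subset_sets[OF \<mu> this sub] have sets: "sg_map p k ` A \<in> sets \<mu>" .
  have "measure \<mu> (sg_map p i -` (sg_map p k ` A) \<inter> K) \<le> (if i = k then measure \<mu> A else 0)"
    if i: "i < N" for i
  proof (cases "i = k")
    case True
    have "sg_map p k -` (sg_map p k ` A) \<inter> K = A" using A by (auto simp: sg_map_inj)
    then show ?thesis using True by simp
  next
    case False
    have "sg_map p i -` (sg_map p k ` A) \<inter> K \<subseteq> {p k}"
    proof
      fix x assume "x \<in> sg_map p i -` (sg_map p k ` A) \<inter> K"
      then obtain y where "x \<in> K" "y \<in> A" "sg_map p i x = sg_map p k y" by auto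
      then show "x \<in> {p k}" using cells_meet(1)[OF _ _ i k False] A by blast
    qed
    then have "measure \<mu> (sg_map p i -` (sg_map p k ` A) \<inter> K) \<le> measure \<mu> {p k}"
      by (rule finite_measure_mono) (rule compact_subset_sets[OF \<mu>], use vertex_in_K[OF k] in auto)
    then show ?thesis using False measure_vertex[OF \<mu> k] by simp
  qed
  then have "(\<Sum>i<N. measure \<mu> (sg_map p i -` (sg_map p k ` A) \<inter> K)) \<le> (\<Sum>i<N. if i = k then measure \<mu> A else 0)"
    by (intro sum_mono) auto
  also have "\<dots> = measure \<mu> A" using k by simp
  finally have "measure \<mu> (sg_map p k ` A) \<le> (1 / real N) * measure \<mu> A"
    unfolding bernoulli_self_similar[OF \<mu> sets] by (intro mult_left_mono) auto
  also have "\<dots> \<le> (1 / real N) * (1 / real N) ^ length w"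
    using Cons.IH[OF w] unfolding A_def by (intro mult_left_mono) auto
  finally show ?case by (simp add: A_def image_comp)
qed

lemma laplacian_test_bound:
  assumes \<mu>: "is_standard_bernoulli N p K \<mu>" and f: "continuous_on K f"
    and M: "\<And>x. x \<in> K \<Longrightarrow> \<bar>f x\<bar> \<le> M"
    and ij: "i < N" "j < N" "i \<noteq> j" and w: "set w \<subseteq> {..<N}"
  shows "\<bar>LINT x|\<mu>. f x * cell_spike w i j x\<bar> \<le> M / real N ^ length w"
proof -
  interpret prob_space \<mu> using \<mu> by (simp add: is_standard_bernoulli_def)
  have sp: "space \<mu> = K" and st: "sets \<mu> = sets (restrict_space borel K)"
    using \<mu> by (auto simp: is_standard_bernoulli_def)
  have M0: "M \<ge> 0" using M[OF vertex_in_K[OF ij(1)]] by linarith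
  define C where "C = sg_word_map p w ` K"
  have C: "C \<in> sets \<mu>" unfolding C_def
    by (intro compact_subset_sets[OF \<mu>] compact_continuous_image continuous_on_sg_word_map compact_K
        sg_word_cell_subset w)
  have bound: "norm (f x * cell_spike w i j x) \<le> M * indicator C x" if x: "x \<in> K" for x
  proof (cases "cell_spike w i j x = 0")
    case True
    then show ?thesis using M0 by simp
  next
    case False
    then have "x \<in> C" unfolding C_def by (rule cell_spike_support[OF ij w x])
    moreover have "\<bar>f x\<bar> * \<bar>cell_spike w i j x\<bar> \<le> M * 1"
      by (intro mult_mono M x M0) (use cell_spike_bounds[OF ij w x] in auto)
    ultimately show ?thesis by (simp add: abs_mult)
  qed
  have "continuous_on K (\<lambda>x. f x * cell_spike w i j x)"
    by (intro continuous_intros f continuous_on_cell_spike ij w)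
  then have "(\<lambda>x. f x * cell_spike w i j x) \<in> borel_measurable (restrict_space borel K)"
    by (rule borel_measurable_continuous_on_restrict)
  then have meas: "(\<lambda>x. f x * cell_spike w i j x) \<in> borel_measurable \<mu>"
    using measurable_cong_sets[OF st refl] by blast
  have "norm (f x * cell_spike w i j x) \<le> M" if "x \<in> K" for x
  proof -
    have "M * indicator C x \<le> M" using M0 by (simp add: indicator_def)
    then show ?thesis using bound[OF that] by linarith
  qed
  then have int: "integrable \<mu> (\<lambda>x. f x * cell_spike w i j x)"
    by (intro integrable_const_bound[of _ M] meas AE_I2) (simp add: sp)
  have "integrable \<mu> (\<lambda>x. M * indicator C x)"
    using C by (intro integrable_mult_right) (simp add: emeasure_eq_measure)
  then have "norm (LINT x|\<mu>. f x * cell_spike w i j x) \<le> (LINT x|\<mu>. M * indicator C x)"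
    by (rule Bochner_Integration.integral_norm_bound_integral[OF int])
      (rule bound, simp add: sp)
  also have "\<dots> = M * measure \<mu> C" using sets.sets_into_space[OF C] by (simp add: Int_absorb2)
  also have "\<dots> \<le> M * (1 / real N) ^ length w"
    unfolding C_def by (intro mult_left_mono measure_cell[OF \<mu> w] M0)
  finally show ?thesis by (simp add: power_divide)
qed

text \<open>
  Testing the Laplacian with the tent in the cell of \<open>w\<close> bounds the midpoint Laplacian of \<open>u\<close> there:
  the energy carries the factor \<open>((N + 2)/N)^(|w| + 1)\<close> and the integral is at most \<open>M N^-|w|\<close>. The
  maximum principle turns this into a bound on the deviation from harmonic extension.
\<close>

lemma harmonic_deviation_bound:
  assumes \<mu>: "is_standard_bernoulli N p K \<mu>" and u: "has_laplacian N p K \<mu> u f"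
    and M: "\<And>x. x \<in> K \<Longrightarrow> \<bar>f x\<bar> \<le> M"
    and w: "set w \<subseteq> {..<N}" and ij: "i < N" "j < N"
  shows "\<bar>u (sg_word_map p w (sg_map p i (p j))) - ext_step N i (\<lambda>k. u (sg_word_map p w (p k))) j\<bar>
    \<le> M / (real N + 2) ^ length w"
proof -
  have f: "continuous_on K f" using u by (simp add: has_laplacian_def)
  have M0: "M \<ge> 0" using M[OF vertex_in_K[OF ij(1)]] by linarith
  define m where "m i j = u (sg_word_map p w (sg_map p i (p j)))" for i j
  have "\<bar>2 * real N * m i j - sum (m i) {..<N} - sum (m j) {..<N}\<bar> \<le> M / (real N + 2) ^ length w"
    (is "\<bar>?L\<bar> \<le> _") if "i < N" "j < N" "i \<noteq> j" for i j
  proof -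
    have "sg_energy N p u (cell_spike w i j) = - (LINT x|\<mu>. f x * cell_spike w i j x)"
      using u cell_spike_energy(1)[OF that w] unfolding has_laplacian_def by blast
    then have "\<bar>((real N + 2) / real N) ^ Suc (length w) * ?L\<bar> \<le> M / real N ^ length w"
      using laplacian_test_bound[OF \<mu> f M that w]
      unfolding cell_spike_energy(2)[OF that w] midpoint_laplacian_def m_def by simp
    then have "(real N + 2) / real N * ((real N + 2) ^ length w * \<bar>?L\<bar>) / real N ^ length w \<le> M / real N ^ length w"
      by (simp add: abs_mult power_divide)
    moreover have "real N ^ length w > 0" using N_ge_3 by simp
    ultimately have "(real N + 2) / real N * ((real N + 2) ^ length w * \<bar>?L\<bar>) \<le> M"
      unfolding divide_le_cancel by blast
    moreover have "1 * ((real N + 2) ^ length w * \<bar>?L\<bar>) \<le> (real N + 2) / real N * ((real N + 2) ^ length w * \<bar>?L\<bar>)"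
      using N_ge_3 by (intro mult_right_mono) auto
    ultimately have "\<bar>?L\<bar> * (real N + 2) ^ length w \<le> M" by (simp add: mult.commute)
    then show ?thesis by (simp add: pos_le_divide_eq)
  qed
  then have "\<bar>m i j - ext_step N i (\<lambda>k. m k k) j\<bar> \<le> M / (real N + 2) ^ length w / 2"
    using M0 by (intro discrete_maximum_principle ij) (auto simp: m_def sg_map_swap)
  also have "\<dots> \<le> M / (real N + 2) ^ length w"
  proof -
    have half: "c / 2 \<le> c" if "0 \<le> c" for c :: real using that by simp
    show ?thesis by (rule half) (use M0 in simp)
  qed
  finally show ?thesis by (simp add: m_def sg_map_vertex)
qed

end

section \<open>Blocks and convergence of the gradient\<close>

text \<open>
  If \<open>C n \<ge> y ln n\<close> with \<open>y \<bar>ln \<beta>\<bar> = s > 1\<close>, then \<open>\<beta> ^ C n \<le> n powr - s\<close>.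
\<close>

lemma summable_power_liminf:
  fixes C :: "nat \<Rightarrow> nat" and \<beta> :: real
  assumes \<beta>: "0 < \<beta>" "\<beta> < 1"
    and lim: "liminf (\<lambda>n. ereal (real (C n) / ln (real n))) > ereal (1 / \<bar>ln \<beta>\<bar>)"
  shows "summable (\<lambda>n. \<beta> ^ C n)"
proof -
  obtain y where y: "ereal (1 / \<bar>ln \<beta>\<bar>) < ereal y"
      "ereal y < liminf (\<lambda>n. ereal (real (C n) / ln (real n)))"
    using ereal_dense2[OF lim] by blast
  have lb: "ln \<beta> < 0" using \<beta> by simp
  define s where "s = y * \<bar>ln \<beta>\<bar>"
  have "s > 1" using y(1) lb by (simp add: s_def field_simps)
  have ev: "\<forall>\<^sub>F n in sequentially. ereal y < ereal (real (C n) / ln (real n))"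
    using less_LiminfD[OF y(2)] .
  have "\<forall>\<^sub>F n in sequentially. norm (\<beta> ^ C n) \<le> real n powr (- s)"
    using ev eventually_ge_at_top[of 2]
  proof eventually_elim
    case (elim n)
    have ln: "ln (real n) > 0" using elim by simp
    have "y * ln (real n) \<le> real (C n)" using elim ln by (simp add: field_simps)
    then have "y * ln (real n) * \<bar>ln \<beta>\<bar> \<le> real (C n) * \<bar>ln \<beta>\<bar>" by (rule mult_right_mono) simp
    then have "real (C n) * ln \<beta> \<le> - s * ln (real n)" using lb by (simp add: s_def mult_ac)
    then have "exp (real (C n) * ln \<beta>) \<le> exp (- s * ln (real n))" by simp
    moreover have "\<beta> ^ C n = exp (real (C n) * ln \<beta>)"
      using \<beta> by (simp add: powr_realpow[symmetric] powr_def)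
    moreover have "real n powr (- s) = exp (- s * ln (real n))" using elim by (simp add: powr_def)
    ultimately show ?case using \<beta> by simp
  qed
  moreover have "summable (\<lambda>n. real n powr (- s))"
    using \<open>s > 1\<close> by (simp add: summable_real_powr_iff)
  ultimately show ?thesis by (rule summable_comparison_test_ev)
qed

lemma word_prefix_add: "word_prefix \<omega> (k + l) = word_prefix \<omega> k @ map \<omega> [k..<k + l]"
  using upt_add_eq_append[of 0 k l] by (simp add: word_prefix_def)

lemma word_prefix_Suc: "word_prefix \<omega> (Suc n) = word_prefix \<omega> n @ [\<omega> n]"
  by (simp add: word_prefix_def)

lemma set_word_prefix: "(\<And>i. \<omega> i < N) \<Longrightarrow> set (word_prefix \<omega> n) \<subseteq> {..<N}"
  by (auto simp: word_prefix_def)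

lemma length_word_prefix [simp]: "length (word_prefix \<omega> n) = n"
  by (simp add: word_prefix_def)

lemma finite_block_windows: "finite {i. i + (N - 1) \<le> n \<and> map \<omega> [i..<i + (N - 1)] \<in> blocks N}"
  by (rule finite_subset[of _ "{..n}"]) auto

text \<open>
  Between the prefixes of length \<open>k\<close> and \<open>k + (N - 1)\<close> at most \<open>N - 1\<close> new windows end.
\<close>

lemma block_count_add: "block_count N \<omega> (k + (N - 1)) \<le> block_count N \<omega> k + (N - 1)"
proof -
  let ?P = "\<lambda>i. map \<omega> [i..<i + (N - 1)] \<in> blocks N"
  have "{i. i + (N - 1) \<le> k + (N - 1) \<and> ?P i} \<subseteq> {i. i + (N - 1) \<le> k \<and> ?P i} \<union> {Suc k - (N - 1)..k}"
    by auto
  then have "block_count N \<omega> (k + (N - 1)) \<le> card ({i. i + (N - 1) \<le> k \<and> ?P i} \<union> {Suc k - (N - 1)..k})"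
    unfolding block_count_def by (intro card_mono finite_UnI finite_block_windows) auto
  also have "\<dots> \<le> block_count N \<omega> k + card {Suc k - (N - 1)..k}"
    unfolding block_count_def by (rule card_Un_le)
  finally show ?thesis by simp
qed

lemma block_count_Suc_le:
  assumes "\<And>i. i + (N - 1) = Suc n \<Longrightarrow> map \<omega> [i..<i + (N - 1)] \<notin> blocks N"
  shows "block_count N \<omega> (Suc n) \<le> block_count N \<omega> n"
  unfolding block_count_def
proof (rule card_mono[OF finite_block_windows], rule subsetI)
  fix i assume i: "i \<in> {i. i + (N - 1) \<le> Suc n \<and> map \<omega> [i..<i + (N - 1)] \<in> blocks N}"
  then have "i + (N - 1) \<noteq> Suc n" using assms by blast
  then show "i \<in> {i. i + (N - 1) \<le> n \<and> map \<omega> [i..<i + (N - 1)] \<in> blocks N}" using i by auto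
qed

lemma sqrt_complete_form_le:
  assumes e: "\<And>i. i < N \<Longrightarrow> \<bar>a i\<bar> \<le> e" and "e \<ge> 0"
  shows "sqrt (complete_form N a a) \<le> 2 * real N * e"
proof -
  have "(a i - a j) * (a i - a j) \<le> (2 * e)\<^sup>2" if "i < N" "j < N" for i j
  proof -
    have "\<bar>a i - a j\<bar> \<le> 2 * e" using e[OF that(1)] e[OF that(2)] by linarith
    then have "\<bar>a i - a j\<bar>\<^sup>2 \<le> (2 * e)\<^sup>2" by (rule power_mono) simp
    then show ?thesis by (simp add: power2_eq_square)
  qed
  then have "(\<Sum>i<N. \<Sum>j<N. (a i - a j) * (a i - a j)) \<le> (\<Sum>i<N. \<Sum>j<N. (2 * e)\<^sup>2)"
    by (intro sum_mono) auto
  then have "(\<Sum>i<N. \<Sum>j<N. (a i - a j) * (a i - a j)) \<le> (2 * real N * e)\<^sup>2"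
    by (simp add: power2_eq_square mult_ac)
  then have "complete_form N a a \<le> (1/2) * (2 * real N * e)\<^sup>2"
    unfolding complete_form_def by (rule mult_left_mono) simp
  also have "\<dots> \<le> (2 * real N * e)\<^sup>2" by simp
  finally show ?thesis by (rule real_le_lsqrt[rotated]) (use assms in auto)
qed

context gasket
begin

text \<open>
  Cut the prefix from its end. If its last \<open>N - 1\<close> letters form a block, the block is removed as a
  whole with the gain \<open>\<beta> ^ (N - 1)\<close>, while the number of counted windows, overlaps included, drops by
  at most \<open>N - 1\<close>. Otherwise the last letter is removed without gain, and no window is lost. Thus
  overlapping windows each contribute a full factor \<open>\<beta>\<close>.
\<close>

lemma boundary_norm_prefix:
  assumes \<beta>: "0 < \<beta>" "\<beta> < 1" and \<omega>: "\<And>i. \<omega> i < N"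
    and block: "\<And>w h. w \<in> blocks N \<Longrightarrow> locally_harmonic h \<Longrightarrow>
      boundary_norm h \<le> ((real N + 2) * \<beta>) ^ (N - 1) * boundary_norm (h \<circ> sg_word_map p w)"
    and h: "locally_harmonic h"
  shows "boundary_norm h \<le> (real N + 2) ^ n * \<beta> ^ block_count N \<omega> n
      * boundary_norm (h \<circ> sg_word_map p (word_prefix \<omega> n))"
proof (induction n rule: less_induct)
  case (less n)
  let ?D = "real N + 2" and ?L = "N - 1"
  let ?b = "\<lambda>n. boundary_norm (h \<circ> sg_word_map p (word_prefix \<omega> n))"
  have LH: "locally_harmonic (h \<circ> sg_word_map p (word_prefix \<omega> k))" for k
    by (rule locally_harmonic_comp[OF h set_word_prefix[OF \<omega>]])
  show ?case
  proof (cases "\<exists>k. k + ?L = n \<and> map \<omega> [k..<k + ?L] \<in> blocks N")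
    case True
    then obtain k where k: "n = k + ?L" and blk: "map \<omega> [k..<k + ?L] \<in> blocks N" by auto
    have "k < n" using k N_ge_3 by simp
    have count: "block_count N \<omega> n \<le> block_count N \<omega> k + ?L" unfolding k by (rule block_count_add)
    have "boundary_norm h \<le> ?D ^ k * \<beta> ^ block_count N \<omega> k * ?b k" by (rule less[OF \<open>k < n\<close>])
    also have "\<dots> \<le> ?D ^ k * \<beta> ^ block_count N \<omega> k * ((?D * \<beta>) ^ ?L * ?b n)"
      using block[OF blk LH[of k]] \<beta>
      unfolding k word_prefix_add sg_word_map_append comp_assoc by (intro mult_left_mono) auto
    also have "\<dots> = ?D ^ n * \<beta> ^ (block_count N \<omega> k + ?L) * ?b n"
      unfolding power_mult_distrib power_add k by (simp only: mult_ac)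
    also have "\<dots> \<le> ?D ^ n * \<beta> ^ block_count N \<omega> n * ?b n"
      using \<beta> count by (intro mult_right_mono mult_left_mono power_decreasing boundary_norm_nonneg) auto
    finally show ?thesis .
  next
    case False
    show ?thesis
    proof (cases n)
      case 0
      have "{i. i + (N - 1) \<le> 0 \<and> map \<omega> [i..<i + (N - 1)] \<in> blocks N} = {}" using N_ge_3 by auto
      then have "block_count N \<omega> 0 = 0" unfolding block_count_def by (simp only: card.empty)
      then show ?thesis using 0 by (simp add: word_prefix_def)
    next
      case (Suc m)
      have count: "block_count N \<omega> n \<le> block_count N \<omega> m"
        unfolding Suc by (rule block_count_Suc_le) (use False Suc in auto)
      have "boundary_norm h \<le> ?D ^ m * \<beta> ^ block_count N \<omega> m * ?b m" by (rule less) (simp add: Suc)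
      also have "\<dots> \<le> ?D ^ m * \<beta> ^ block_count N \<omega> m * (?D * ?b n)"
      proof -
        have "?b m \<le> ?D * boundary_norm (h \<circ> sg_word_map p (word_prefix \<omega> m) \<circ> sg_map p (\<omega> m))"
          by (rule boundary_norm_step[OF LH \<omega>])
        also have "h \<circ> sg_word_map p (word_prefix \<omega> m) \<circ> sg_map p (\<omega> m) = h \<circ> sg_word_map p (word_prefix \<omega> n)"
          unfolding Suc word_prefix_Suc sg_word_map_append comp_assoc by simp
        finally have step: "?b m \<le> ?D * ?b n" .
        show ?thesis by (rule mult_left_mono[OF step]) (use \<beta> in simp)
      qed
      also have "\<dots> = ?D ^ n * \<beta> ^ block_count N \<omega> m * ?b n"
        unfolding Suc power_Suc by (simp only: mult_ac)
      also have "\<dots> \<le> ?D ^ n * \<beta> ^ block_count N \<omega> n * ?b n"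
        using \<beta> count by (intro mult_right_mono mult_left_mono power_decreasing boundary_norm_nonneg) auto
      finally show ?thesis .
    qed
  qed
qed

lemma harmonic_ext_spec:
  "locally_harmonic (harmonic_ext N p K g)" "j < N \<Longrightarrow> harmonic_ext N p K g (p j) = g (p j)"
proof -
  have "harm (g \<circ> p) \<in> harmonic_fun N p K \<and> (\<forall>x\<in>sg_boundary N p. harm (g \<circ> p) x = g x)"
    by (auto simp: harmonic_fun_iff locally_harmonic_harm sg_boundary_def harm_vertex)
  then have "harmonic_ext N p K g \<in> harmonic_fun N p K \<and> (\<forall>x\<in>sg_boundary N p. harmonic_ext N p K g x = g x)"
    unfolding harmonic_ext_def
    by (rule someI[where P = "\<lambda>h. h \<in> harmonic_fun N p K \<and> (\<forall>x\<in>sg_boundary N p. h x = g x)"])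
  then show "locally_harmonic (harmonic_ext N p K g)" "j < N \<Longrightarrow> harmonic_ext N p K g (p j) = g (p j)"
    by (auto simp: harmonic_fun_iff sg_boundary_def)
qed

text \<open>
  The harmonic function fitted to \<open>u\<close> on a cell continues, by the invertibility of the maps \<open>A\<^sub>i\<close>, to
  a harmonic function on the whole gasket; the continuation represents the gradient.
\<close>

lemma gradient_level_class:
  assumes \<omega>: "\<And>i. \<omega> i < N"
  shows "\<exists>g. locally_harmonic g \<and> gradient_level N p K u \<omega> n = hq_class N p K g \<and>
    (\<forall>j<N. g (sg_word_map p (word_prefix \<omega> n) (p j)) = u (sg_word_map p (word_prefix \<omega> n) (p j)))"
proof -
  let ?w = "word_prefix \<omega> n"
  let ?k = "harmonic_ext N p K (u \<circ> sg_word_map p ?w)"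
  have w: "set ?w \<subseteq> {..<N}" by (rule set_word_prefix[OF \<omega>])
  obtain g where g: "locally_harmonic g" "\<forall>x\<in>K. g (sg_word_map p ?w x) = ?k x"
    using locally_harmonic_lift[OF harmonic_ext_spec(1) w] by blast
  have "hq_class N p K ?k = hq_class N p K (g \<circ> sg_word_map p ?w)"
    by (rule hq_class_eqI[OF harmonic_ext_spec(1) locally_harmonic_comp[OF g(1) w], where c = 0])
      (simp add: g(2))
  then have "gradient_level N p K u \<omega> n = hq_class N p K g"
    unfolding gradient_level_def by (simp only: hq_word_inv_class[OF g(1) w])
  moreover have "g (sg_word_map p ?w (p j)) = u (sg_word_map p ?w (p j))" if "j < N" for j
    using g(2)[rule_format, OF vertex_in_K[OF that]] harmonic_ext_spec(2)[OF that, of "u \<circ> sg_word_map p ?w"]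
    by simp
  ultimately show ?thesis using g(1) by blast
qed

text \<open>
  Two successive gradients come from harmonic functions \<open>g\<close> and \<open>k\<close> fitted to \<open>u\<close> on a cell and on one of its
  subcells. On the vertices of the subcell their difference is exactly the deviation of \<open>u\<close> from
  harmonic extension.
\<close>

lemma gradient_increment_bound:
  assumes \<mu>: "is_standard_bernoulli N p K \<mu>" and u: "has_laplacian N p K \<mu> u f"
    and M: "\<And>x. x \<in> K \<Longrightarrow> \<bar>f x\<bar> \<le> M"
    and w: "set w \<subseteq> {..<N}" and i: "i < N"
    and g: "locally_harmonic g" "\<And>j. j < N \<Longrightarrow> g (sg_word_map p w (p j)) = u (sg_word_map p w (p j))"
    and k: "\<And>j. j < N \<Longrightarrow> k (sg_word_map p (w @ [i]) (p j)) = u (sg_word_map p (w @ [i]) (p j))"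
  shows "boundary_norm ((\<lambda>x. k x - g x) \<circ> sg_word_map p (w @ [i])) \<le> 2 * real N * (M / (real N + 2) ^ length w)"
  unfolding boundary_norm_def
proof (rule sqrt_complete_form_le)
  have M0: "M \<ge> 0" using M[OF vertex_in_K[OF i]] by linarith
  then show "0 \<le> M / (real N + 2) ^ length w" by simp
  fix j assume j: "j < N"
  have "g (sg_word_map p w (sg_map p i (p j))) = ext_step N i (\<lambda>k. g (sg_word_map p w (p k))) j"
    by (rule locally_harmonicD[OF g(1) w i j])
  also have "\<dots> = ext_step N i (\<lambda>k. u (sg_word_map p w (p k))) j"
    by (rule ext_step_cong[OF i j g(2)])
  finally have "((\<lambda>x. k x - g x) \<circ> sg_word_map p (w @ [i]) \<circ> p) j
      = u (sg_word_map p w (sg_map p i (p j))) - ext_step N i (\<lambda>k. u (sg_word_map p w (p k))) j"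
    using k[OF j] by (simp add: sg_word_map_append)
  then show "\<bar>((\<lambda>x. k x - g x) \<circ> sg_word_map p (w @ [i]) \<circ> p) j\<bar> \<le> M / (real N + 2) ^ length w"
    using harmonic_deviation_bound[OF \<mu> u M w i j] by simp
qed

text \<open>
  Completeness of the quotient, made explicit: vertex values normalised to vanish at \<open>p\<^sub>0\<close> are
  controlled by the norm, hence converge, and the limit values define the gradient.
\<close>

lemma gradient_exists_if_summable:
  assumes g: "\<And>n. locally_harmonic (g n)"
    and level: "\<And>n. gradient_level N p K u \<omega> n = hq_class N p K (g n)"
    and sum: "summable (\<lambda>n. boundary_norm (\<lambda>x. g (Suc n) x - g n x))"
  shows "harmonic_gradient_defined N p K u \<omega>"
proof -
  have N: "0 < N" using N_ge_3 by simp
  define b where "b j n = g n (p j) - g n (p 0)" for j n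
  have conv: "convergent (b j)" if j: "j < N" for j
  proof -
    have "norm (b j (Suc n) - b j n) \<le> boundary_norm (\<lambda>x. g (Suc n) x - g n x)" for n
      using diff_le_sqrt_complete_form[OF j N, of "(\<lambda>x. g (Suc n) x - g n x) \<circ> p"]
      by (simp add: b_def boundary_norm_def algebra_simps)
    then have "summable (\<lambda>n. b j (Suc n) - b j n)"
      by (intro summable_comparison_test'[OF sum, of 0])
    then have "convergent (\<lambda>m. \<Sum>n<m. b j (Suc n) - b j n)"
      by (simp add: summable_iff_convergent)
    then have "convergent (\<lambda>m. b j m - b j 0)" by (simp add: sum_lessThan_telescope)
    then show ?thesis by (simp add: convergent_diff_const_right_iff)
  qed
  define a where "a j = lim (b j)" for j
  define G where "G = hq_class N p K (harm a)"
  have lim: "b j \<longlonglongrightarrow> a j" if "j < N" for j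
    using conv[OF that] unfolding a_def by (simp add: convergent_LIMSEQ_iff)
  have "hq_norm N p (hq_diff N p K (gradient_level N p K u \<omega> n) G)
      = sqrt (complete_form N (\<lambda>j. b j n - a j) (\<lambda>j. b j n - a j))" for n
  proof -
    have "hq_norm N p (hq_diff N p K (gradient_level N p K u \<omega> n) G)
        = boundary_norm (\<lambda>x. g n x - harm a x)"
      unfolding level G_def hq_diff_class[OF g locally_harmonic_harm]
      by (rule hq_norm_class[OF locally_harmonic_diff[OF g locally_harmonic_harm]])
    also have "\<dots> = sqrt (complete_form N (\<lambda>j. b j n - a j) (\<lambda>j. b j n - a j))"
      unfolding boundary_norm_def
      by (rule arg_cong[of _ _ sqrt], rule complete_form_shift[of _ _ _ "g n (p 0)"])
        (simp add: b_def harm_vertex)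
    finally show ?thesis .
  qed
  moreover have "(\<lambda>n. sqrt (complete_form N (\<lambda>j. b j n - a j) (\<lambda>j. b j n - a j))) \<longlonglongrightarrow>
      sqrt (1 / 2 * (\<Sum>i<N. \<Sum>j<N. ((a i - a i) - (a j - a j)) * ((a i - a i) - (a j - a j))))"
    unfolding complete_form_def by (intro tendsto_intros lim) auto
  ultimately have "(\<lambda>n. hq_norm N p (hq_diff N p K (gradient_level N p K u \<omega> n) G)) \<longlonglongrightarrow> 0"
    by simp
  moreover have "G \<in> harmonic_quot N p K"
    unfolding G_def harmonic_quot_eq using locally_harmonic_harm by blast
  ultimately show ?thesis unfolding harmonic_gradient_defined_def has_harmonic_gradient_def by blast
qed

text \<open>
  Positivity of the operator norm, and hence of \<open>\<beta>\<close>, is seen on a nonconstant harmonic function. It is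
  needed to undo the power \<open>1/(N - 1)\<close>.
\<close>

lemma block_opnorm_bound:
  assumes \<beta>: "\<And>w. w \<in> blocks N \<Longrightarrow>
      1 / (real N + 2) * hq_opnorm N p K (hq_word_inv N p K w) powr (1 / (real N - 1)) \<le> \<beta>"
    and w: "w \<in> blocks N"
  shows "0 < \<beta>"
    and "locally_harmonic h \<Longrightarrow>
      boundary_norm h \<le> ((real N + 2) * \<beta>) ^ (N - 1) * boundary_norm (h \<circ> sg_word_map p w)"
proof -
  have ws: "set w \<subseteq> {..<N}" using w by (simp add: blocks_def sg_words_def)
  define s where "s = hq_opnorm N p K (hq_word_inv N p K w)"
  let ?r = "s powr (1 / (real N - 1))"
  let ?k = "harm (\<lambda>l. if l = 0 then 1 else 0)"
  have "1 \<le> boundary_norm ?k"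
    using diff_le_sqrt_complete_form[of 0 N 1 "?k \<circ> p"] N_ge_3
    by (simp add: boundary_norm_def harm_vertex)
  also have "\<dots> \<le> s * boundary_norm (?k \<circ> sg_word_map p w)"
    unfolding s_def by (rule hq_opnorm_bound[OF locally_harmonic_harm ws])
  finally have "0 < s * boundary_norm (?k \<circ> sg_word_map p w)" by simp
  then have s: "s > 0" using boundary_norm_nonneg[of "?k \<circ> sg_word_map p w"]
    by (simp add: zero_less_mult_iff)
  have r: "?r \<le> (real N + 2) * \<beta>"
    using \<beta>[OF w] by (simp add: s_def field_simps)
  moreover have "?r > 0" using s by simp
  ultimately have "0 < (real N + 2) * \<beta>" by linarith
  then show "0 < \<beta>" by (simp add: zero_less_mult_iff)
  have "real (N - 1) = real N - 1" using N_ge_3 by simp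
  then have "?r ^ (N - 1) = s"
    using s N_ge_3 by (simp add: powr_powr flip: powr_realpow)
  then have "s \<le> ((real N + 2) * \<beta>) ^ (N - 1)"
    using power_mono[OF r, of "N - 1"] by simp
  then have "s * boundary_norm (h \<circ> sg_word_map p w)
      \<le> ((real N + 2) * \<beta>) ^ (N - 1) * boundary_norm (h \<circ> sg_word_map p w)"
    by (rule mult_right_mono) (rule boundary_norm_nonneg)
  then show "boundary_norm h \<le> ((real N + 2) * \<beta>) ^ (N - 1) * boundary_norm (h \<circ> sg_word_map p w)"
    if "locally_harmonic h"
    using hq_opnorm_bound[OF that ws] unfolding s_def by linarith
qed

end

lemma blocks_nonempty: "[0..<N - 1] \<in> blocks N"
  by (auto simp: blocks_def sg_words_def)

theorem theorem5p5:
  fixes N :: nat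
    and p :: "nat \<Rightarrow> 'a::euclidean_space"
    and K :: "'a set"
    and \<mu> :: "'a measure"
    and \<beta> :: real
    and u :: "'a \<Rightarrow> real"
    and \<omega> :: "nat \<Rightarrow> nat"
  assumes "N \<ge> 3"
    and "DIM('a) = N - 1"
    and "unit_simplex N p"
    and "is_gasket N p K"
    and "is_standard_bernoulli N p K \<mu>"
    and "\<beta> < 1"
    and "\<And>w. w \<in> blocks N \<Longrightarrow>
      1 / (real N + 2) * hq_opnorm N p K (hq_word_inv N p K w) powr (1 / (real N - 1)) \<le> \<beta>"
    and "u \<in> dom_laplacian N p K \<mu>"
    and "\<And>i. \<omega> i < N"
    and "liminf (\<lambda>n. ereal (real (block_count N \<omega> n) / ln (real n))) > ereal (1 / \<bar>ln \<beta>\<bar>)"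
  shows "harmonic_gradient_defined N p K u \<omega>"
proof -
  interpret gasket N p K using assms(1,3,4) by unfold_locales
  note \<omega> = assms(9)
  have \<beta>: "0 < \<beta>" by (rule block_opnorm_bound(1)[OF assms(7) blocks_nonempty])
  obtain f where u: "has_laplacian N p K \<mu> u f" using assms(8) by (auto simp: dom_laplacian_def)
  have "bounded (f ` K)"
    using u by (intro compact_imp_bounded compact_continuous_image compact_K) (simp add: has_laplacian_def)
  then obtain M where M: "\<bar>f x\<bar> \<le> M" if "x \<in> K" for x by (auto simp: bounded_iff)
  let ?w = "word_prefix \<omega>"
  have "\<exists>g. \<forall>n. locally_harmonic (g n) \<and> gradient_level N p K u \<omega> n = hq_class N p K (g n) \<and>
    (\<forall>j<N. g n (sg_word_map p (?w n) (p j)) = u (sg_word_map p (?w n) (p j)))"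
    by (intro choice allI gradient_level_class \<omega>)
  then obtain g where g: "\<And>n. locally_harmonic (g n)"
    "\<And>n. gradient_level N p K u \<omega> n = hq_class N p K (g n)"
    "\<And>n j. j < N \<Longrightarrow> g n (sg_word_map p (?w n) (p j)) = u (sg_word_map p (?w n) (p j))" by blast
  \<comment> \<open>One factor \<open>N + 2\<close> is left over: the increment is measured at level \<open>n\<close> and pulled back from level \<open>n + 1\<close>.\<close>
  define C where "C = (real N + 2) * (2 * real N * M)"
  have bound: "boundary_norm (\<lambda>x. g (Suc n) x - g n x) \<le> C * \<beta> ^ block_count N \<omega> (Suc n)" for n
  proof -
    let ?d = "\<lambda>x. g (Suc n) x - g n x"
    have "boundary_norm ?d \<le> (real N + 2) ^ Suc n * \<beta> ^ block_count N \<omega> (Suc n)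
        * boundary_norm (?d \<circ> sg_word_map p (?w (Suc n)))"
      by (intro boundary_norm_prefix \<beta> assms(6) \<omega> block_opnorm_bound(2)[OF assms(7)]
          locally_harmonic_diff g)
    also have "boundary_norm (?d \<circ> sg_word_map p (?w (Suc n))) \<le> 2 * real N * (M / (real N + 2) ^ length (?w n))"
      unfolding word_prefix_Suc
      by (rule gradient_increment_bound[OF assms(5) u M set_word_prefix[OF \<omega>] \<omega> g(1)])
        (use g(3) g(3)[of _ "Suc n", unfolded word_prefix_Suc] in auto)
    also have "(real N + 2) ^ Suc n * \<beta> ^ block_count N \<omega> (Suc n)
        * (2 * real N * (M / (real N + 2) ^ length (?w n))) = C * \<beta> ^ block_count N \<omega> (Suc n)"
      by (simp add: C_def)
    finally show ?thesis using \<beta> by (simp add: mult_left_mono)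
  qed
  have "summable (\<lambda>n. \<beta> ^ block_count N \<omega> n)"
    by (rule summable_power_liminf[OF \<beta> assms(6,10)])
  then have "summable (\<lambda>n. \<beta> ^ block_count N \<omega> (Suc n))"
    using summable_Suc_iff[of "\<lambda>n. \<beta> ^ block_count N \<omega> n"] by simp
  then have "summable (\<lambda>n. C * \<beta> ^ block_count N \<omega> (Suc n))"
    by (rule summable_mult)
  then have "summable (\<lambda>n. boundary_norm (\<lambda>x. g (Suc n) x - g n x))"
    by (rule summable_comparison_test'[of _ 0]) (use bound boundary_norm_nonneg in auto)
  then show ?thesis by (rule gradient_exists_if_summable[OF g(1,2)])
qed

end
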